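(* The graph isomorphism problem for bipartite graphs that contain no induced subgraph isomorphic to $2P_3\mathbin{\dot\cup}K_1$ is isomorphism-complete.
   Context: $P_3$ is the path on 3 vertices, $K_1$ a single vertex, $2P_3$ two disjoint copies of $P_3$, $\dot\cup$ disjoint union. Isomorphism-complete means polynomial-time equivalent to general graph isomorphism. *)

theory Defs
  imports Main "HOL-Computational_Algebra.Polynomial"
begin

section \<open>Finite simple graphs\<close>

type_synonym 'a graph = "'a set \<times> 'a set set"

abbreviation verts :: "'a graph \<Rightarrow> 'a set" where
  "verts G \<equiv> fst G"

abbreviation edges :: "'a graph \<Rightarrow> 'a set set" where
  "edges G \<equiv> snd G"

definition simple_graph :: "'a graph \<Rightarrow> bool" where
  "simple_graph G \<longleftrightarrow> finite (verts G) \<and> (\<forall>e \<in> edges G. e \<subseteq> verts G \<and> card e = 2)"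

definition graph_iso :: "'a graph \<Rightarrow> 'b graph \<Rightarrow> bool" where
  "graph_iso G H \<longleftrightarrow>
     (\<exists>f. bij_betw f (verts G) (verts H) \<and>
          (\<forall>u \<in> verts G. \<forall>v \<in> verts G. {u, v} \<in> edges G \<longleftrightarrow> {f u, f v} \<in> edges H))"

definition induced_subgraph :: "'a graph \<Rightarrow> 'a set \<Rightarrow> 'a graph" where
  "induced_subgraph G S = (S, {e \<in> edges G. e \<subseteq> S})"

definition contains_induced :: "'a graph \<Rightarrow> 'b graph \<Rightarrow> bool" where
  "contains_induced G H \<longleftrightarrow> (\<exists>S \<subseteq> verts G. graph_iso (induced_subgraph G S) H)"

definition bipartite :: "'a graph \<Rightarrow> bool" where
  "bipartite G \<longleftrightarrow>
     (\<exists>A B. A \<union> B = verts G \<and> A \<inter> B = {} \<and> (\<forall>e \<in> edges G. \<exists>a \<in> A. \<exists>b \<in> B. e = {a, b}))"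

definition path_graph :: "nat \<Rightarrow> nat graph" where
  "path_graph n = ({..<n}, {{i, Suc i} | i. Suc i < n})"

definition complete_graph :: "nat \<Rightarrow> nat graph" where
  "complete_graph n = ({..<n}, {{i, j} | i j. i < n \<and> j < n \<and> i \<noteq> j})"

definition disjoint_union :: "'a graph \<Rightarrow> 'b graph \<Rightarrow> ('a + 'b) graph" where
  "disjoint_union G H = (verts G <+> verts H, (image Inl ` edges G) \<union> (image Inr ` edges H))"

definition two_P3_K1 :: "((nat + nat) + nat) graph" where
  "two_P3_K1 =
     disjoint_union (disjoint_union (path_graph 3) (path_graph 3)) (complete_graph 1)"


section \<open>Deterministic multitape Turing machines\<close>

text \<open>
  Tapes are two-way infinite. Symbol 0 is the blank, symbols 1 and 2 stand for the input bits
  False and True, and larger symbols are auxiliary. The start state is 0. A machine halts when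
  its transition function is undefined.
\<close>

datatype dir = Move_Left | Stay | Move_Right

record tm =
  num_tapes :: nat
  num_symbols :: nat
  num_states :: nat
  delta :: "nat \<Rightarrow> nat list \<Rightarrow> (nat \<times> (nat \<times> dir) list) option"

text \<open>
  The transition function only matters on the finitely many arguments covered by this condition,
  since a well-formed machine never leaves them.
\<close>

definition wf_tm :: "tm \<Rightarrow> bool" where
  "wf_tm M \<longleftrightarrow>
     1 \<le> num_tapes M \<and> 3 \<le> num_symbols M \<and> 1 \<le> num_states M \<and>
     (\<forall>q ss q' as. q < num_states M \<longrightarrow> length ss = num_tapes M \<longrightarrow>
        (\<forall>s \<in> set ss. s < num_symbols M) \<longrightarrow> delta M q ss = Some (q', as) \<longrightarrow>
        q' < num_states M \<and> length as = num_tapes M \<and> (\<forall>(s, d) \<in> set as. s < num_symbols M))"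

type_synonym tape = "(int \<Rightarrow> nat) \<times> int"
type_synonym config = "nat \<times> tape list"

fun read_tape :: "tape \<Rightarrow> nat" where
  "read_tape (c, p) = c p"

fun offset :: "dir \<Rightarrow> int" where
  "offset Move_Left = - 1"
| "offset Stay = 0"
| "offset Move_Right = 1"

fun act :: "nat \<times> dir \<Rightarrow> tape \<Rightarrow> tape" where
  "act (s, d) (c, p) = (c(p := s), p + offset d)"

fun step :: "tm \<Rightarrow> config \<Rightarrow> config" where
  "step M (q, ts) =
     (case delta M q (map read_tape ts) of
        None \<Rightarrow> (q, ts)
      | Some (q', as) \<Rightarrow> (q', map2 act as ts))"

fun halted :: "tm \<Rightarrow> config \<Rightarrow> bool" where
  "halted M (q, ts) \<longleftrightarrow> delta M q (map read_tape ts) = None"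

definition written :: "bool list \<Rightarrow> int \<Rightarrow> nat" where
  "written x i =
     (if 0 \<le> i \<and> i < int (length x) then (if x ! nat i then 2 else 1) else 0)"

text \<open>The input is on the first tape, the output on the last.\<close>

definition init_config :: "tm \<Rightarrow> bool list \<Rightarrow> config" where
  "init_config M x = (0, (written x, 0) # replicate (num_tapes M - 1) (\<lambda>_. 0, 0))"

definition has_output :: "config \<Rightarrow> bool list \<Rightarrow> bool" where
  "has_output c y \<longleftrightarrow> fst (last (snd c)) = written y"

definition polytime_computable :: "(bool list \<Rightarrow> bool list) \<Rightarrow> bool" where
  "polytime_computable f \<longleftrightarrow>
     (\<exists>M (p :: nat poly). wf_tm M \<and>
        (\<forall>x. \<exists>t \<le> poly p (length x).
           halted M ((step M ^^ t) (init_config M x)) \<and>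
           has_output ((step M ^^ t) (init_config M x)) (f x)))"


section \<open>Polynomial-time equivalence of decision problems\<close>

text \<open>
  A decision problem consists of its set of (encoded) instances and the set of those instances
  with answer yes. Strings that are not instances carry no requirement.
\<close>

record decision_problem =
  instances :: "bool list set"
  yes_instances :: "bool list set"

definition polytime_reducible :: "decision_problem \<Rightarrow> decision_problem \<Rightarrow> bool" where
  "polytime_reducible P Q \<longleftrightarrow>
     (\<exists>f. polytime_computable f \<and>
        (\<forall>x \<in> instances P.
           f x \<in> instances Q \<and> (x \<in> yes_instances P \<longleftrightarrow> f x \<in> yes_instances Q)))"

definition polytime_equivalent :: "decision_problem \<Rightarrow> decision_problem \<Rightarrow> bool" where
  "polytime_equivalent P Q \<longleftrightarrow> polytime_reducible P Q \<and> polytime_reducible Q P"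


section \<open>Graph isomorphism problems\<close>

definition input_graph :: "nat graph \<Rightarrow> bool" where
  "input_graph G \<longleftrightarrow> simple_graph G \<and> (\<exists>n. verts G = {..<n})"

text \<open>
  The number of vertices in unary, terminated by False, followed by the rows of the adjacency
  matrix. On input graphs this is an injective, prefix-free code, so a pair of graphs can be
  encoded by concatenation.
\<close>

definition encode_graph :: "nat graph \<Rightarrow> bool list" where
  "encode_graph G =
     (let n = card (verts G) in
        replicate n True @ [False] @
        concat (map (\<lambda>i. map (\<lambda>j. {i, j} \<in> edges G) [0..<n]) [0..<n]))"

definition encode_pair :: "nat graph \<Rightarrow> nat graph \<Rightarrow> bool list" where
  "encode_pair G H = encode_graph G @ encode_graph H"

definition isomorphism_problem :: "(nat graph \<Rightarrow> bool) \<Rightarrow> decision_problem" where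
  "isomorphism_problem \<C> =
     \<lparr>instances = {encode_pair G H | G H.
        input_graph G \<and> input_graph H \<and> \<C> G \<and> \<C> H},
      yes_instances = {encode_pair G H | G H.
        input_graph G \<and> input_graph H \<and> \<C> G \<and> \<C> H \<and> graph_iso G H}\<rparr>"

definition isomorphism_complete :: "(nat graph \<Rightarrow> bool) \<Rightarrow> bool" where
  "isomorphism_complete \<C> \<longleftrightarrow>
     polytime_equivalent (isomorphism_problem \<C>) (isomorphism_problem (\<lambda>_. True))"

end

theory Submission
  imports Defs
begin

text \<open>
  Instances of the restricted problem are instances of the general one, so the identity reduces one
  way. Conversely, subdivide each arc of \<open>G\<close> (both orientations of every edge), attach a half-edge to
  each original vertex, and map \<open>G\<close> to the bipartite complement of the resulting incidence structure.
  Every edge there meets at most two vertices, no two edges are parallel, and every edge with two ends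
  has an end of degree 2; by a look at the sides on which the two path centres and the isolated vertex lie, this
  excludes an induced \<open>2P\<^sub>3 + K\<^sub>1\<close> from the bipartite complement. An isomorphism of the images respects
  the two sides: there is a vertex adjacent to all of the vertex side, and the edge side is larger.
  Hence it is an isomorphism of the incidence structures, and \<open>G\<close> can be recovered.

  All pairs \<open>(i, j)\<close> are present whether or not they are arcs, so the adjacency matrix of the image is
  a table indexed by nested loops over vertices of \<open>G\<close>, which a Turing machine prints entry by entry.
\<close>

section \<open>A structured language for Turing machines\<close>

text \<open>Both orientations of an edge are subdivided so that one table over ordered pairs serves
  every graph of a given order and its entries need only equality tests between indices, never an
  order comparison. Subdivision makes one end of every two-ended edge thin; this is what rules out
  an isolated vertex that is itself an edge joining the two path centres. The bipartite complement
  is taken because \<open>two_P3_K1\<close> has few edges: its many non-adjacent pairs across the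
  sides all become incidences, too many for such a sparse structure. Polynomial time refers to
  concrete machines that have to halt in time on every string, so the program, its step count and
  its behaviour on strings that encode nothing are all part of the proof.\<close>

datatype cmd =
    Do "nat list \<Rightarrow> (nat \<times> dir) list"
  | Seq cmd cmd
  | While "nat list \<Rightarrow> bool" cmd

text \<open>The step counts are exact for the compiled machine: a \<open>Do\<close> is one
  transition, each test of a \<open>While\<close> is another, the failing one included, and
  \<open>Seq\<close> costs nothing.\<close>

inductive big_step :: "cmd \<Rightarrow> tape list \<Rightarrow> nat \<Rightarrow> tape list \<Rightarrow> bool" where
  Do: "big_step (Do f) ts 1 (map2 act (f (map read_tape ts)) ts)"
| Seq: "big_step c ts t1 ts1 \<Longrightarrow> big_step d ts1 t2 ts2 \<Longrightarrow> big_step (Seq c d) ts (t1 + t2) ts2"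
| While_False: "\<not> b (map read_tape ts) \<Longrightarrow> big_step (While b c) ts 1 ts"
| While_True: "b (map read_tape ts) \<Longrightarrow> big_step c ts t1 ts1 \<Longrightarrow> big_step (While b c) ts1 t2 ts2 \<Longrightarrow>
    big_step (While b c) ts (1 + t1 + t2) ts2"

section \<open>Compilation of structured programs into transition tables\<close>

fun num_instrs :: "cmd \<Rightarrow> nat" where
  "num_instrs (Do f) = 1"
| "num_instrs (Seq c d) = num_instrs c + num_instrs d"
| "num_instrs (While b c) = Suc (num_instrs c)"

definition keep :: "nat list \<Rightarrow> (nat \<times> dir) list" where
  "keep ss = map (\<lambda>s. (s, Stay)) ss"

text \<open>\<open>compile a e c\<close> is placed at address \<open>a\<close> and leaves to address \<open>e\<close>.\<close>

fun compile :: "nat \<Rightarrow> nat \<Rightarrow> cmd \<Rightarrow> (nat list \<Rightarrow> nat \<times> (nat \<times> dir) list) list" where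
  "compile a e (Do f) = [\<lambda>ss. (e, f ss)]"
| "compile a e (Seq c d) =
     compile a (a + num_instrs c) c @ compile (a + num_instrs c) e d"
| "compile a e (While b c) = (\<lambda>ss. (if b ss then Suc a else e, keep ss)) # compile (Suc a) a c"

text \<open>The one extra state is the exit address of the whole program; \<open>delta\<close> is
  undefined there, so leaving the program is halting. Three symbols suffice because rulers and marks
  reuse the symbol 1.\<close>

definition machine :: "nat \<Rightarrow> cmd \<Rightarrow> tm" where
  "machine k c =
     \<lparr>num_tapes = k, num_symbols = 3, num_states = Suc (num_instrs c),
      delta = (\<lambda>q ss. if q < num_instrs c then Some ((compile 0 (num_instrs c) c ! q) ss) else None)\<rparr>"

fun wf_cmd :: "nat \<Rightarrow> cmd \<Rightarrow> bool" where
  "wf_cmd k (Do f) \<longleftrightarrow>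
     (\<forall>ss. length ss = k \<longrightarrow> (\<forall>s \<in> set ss. s < 3) \<longrightarrow>
        length (f ss) = k \<and> (\<forall>(s, d) \<in> set (f ss). s < 3))"
| "wf_cmd k (Seq c d) \<longleftrightarrow> wf_cmd k c \<and> wf_cmd k d"
| "wf_cmd k (While b c) \<longleftrightarrow> wf_cmd k c"

lemma length_compile [simp]: "length (compile a e c) = num_instrs c"
  by (induction c arbitrary: a e) auto

text \<open>\<open>N\<close> stands for the exit address of the whole program. Start and exit of the
  block are arbitrary because a loop body exits backwards, to its test.\<close>

lemma compile_wf:
  assumes "wf_cmd k c" "i < num_instrs c" "length ss = k" "\<forall>s \<in> set ss. s < 3"
    "(compile a e c ! i) ss = (q, as)" "a + num_instrs c \<le> N" "e \<le> N"
  shows "q \<le> N \<and> length as = k \<and> (\<forall>(s, d) \<in> set as. s < 3)"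
  using assms
proof (induction c arbitrary: a e i)
  case (Do f)
  then show ?case by auto
next
  case (Seq c d)
  show ?case
  proof (cases "i < num_instrs c")
    case True
    then show ?thesis
      using Seq.IH(1)[of i a "a + num_instrs c"] Seq.prems by (simp add: nth_append)
  next
    case False
    then show ?thesis
      using Seq.IH(2)[of "i - num_instrs c" "a + num_instrs c" e] Seq.prems
      by (simp add: nth_append)
  qed
next
  case (While b c)
  show ?case
  proof (cases i)
    case 0
    then show ?thesis using While.prems by (auto simp: keep_def split: if_splits)
  next
    case (Suc j)
    then show ?thesis using While.IH[of j "Suc a" a] While.prems by simp
  qed
qed

lemma wf_machine:
  assumes "wf_cmd k c" "1 \<le> k"
  shows "wf_tm (machine k c)"
  unfolding wf_tm_def
proof (intro conjI allI impI)
  fix q ss q' as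
  assume "q < num_states (machine k c)" "length ss = num_tapes (machine k c)"
    "\<forall>s \<in> set ss. s < num_symbols (machine k c)" "delta (machine k c) q ss = Some (q', as)"
  then have "q' \<le> num_instrs c \<and> length as = k \<and> (\<forall>(s, d) \<in> set as. s < 3)"
    using compile_wf[OF assms(1), of q ss 0 "num_instrs c" q' as "num_instrs c"]
    by (simp add: machine_def split: if_splits)
  then show "q' < num_states (machine k c)" "length as = num_tapes (machine k c)"
    "\<forall>(s, d) \<in> set as. s < num_symbols (machine k c)"
    by (simp_all add: machine_def)
qed (use assms(2) in \<open>simp_all add: machine_def\<close>)

lemma map2_act_keep: "map2 act (keep (map read_tape ts)) ts = ts"
  by (induction ts) (auto simp: keep_def)

text \<open>The machine only has to agree with the compiled block on the addresses of that block, so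
  the block may sit inside a larger program. The induction is on the derivation, since a loop body
  may run many times.\<close>

lemma compile_run:
  assumes "big_step c ts t ts'"
    and "\<forall>i < num_instrs c. \<forall>ss. delta M (a + i) ss = Some ((compile a e c ! i) ss)"
  shows "(step M ^^ t) (a, ts) = (e, ts')"
  using assms
proof (induction arbitrary: a e rule: big_step.induct)
  case (Do f ts)
  then show ?case by simp
next
  case (Seq c ts t1 ts1 d t2 ts2)
  have "(step M ^^ t1) (a, ts) = (a + num_instrs c, ts1)"
  proof (rule Seq.IH(1), intro allI impI)
    fix i ss assume "i < num_instrs c"
    then show "delta M (a + i) ss = Some ((compile a (a + num_instrs c) c ! i) ss)"
      using Seq.prems by (simp add: nth_append)
  qed
  moreover have "(step M ^^ t2) (a + num_instrs c, ts1) = (e, ts2)"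
  proof (rule Seq.IH(2), intro allI impI)
    fix i ss assume "i < num_instrs d"
    then show "delta M (a + num_instrs c + i) ss = Some ((compile (a + num_instrs c) e d ! i) ss)"
      using Seq.prems[rule_format, of "num_instrs c + i" ss] by (simp add: nth_append add.assoc)
  qed
  \<comment> \<open>\<open>funpow_add\<close> performs the second summand first, hence the swap that
    puts the \<open>t1\<close> steps of \<open>c\<close> first.\<close>
  ultimately show ?case by (simp add: add.commute[of t1] funpow_add)
next
  case (While_False b ts c)
  have "delta M a ss = Some (if b ss then Suc a else e, keep ss)" for ss
    using While_False(2)[rule_format, of 0 ss] by simp
  with While_False(1) show ?case by (simp add: map2_act_keep)
next
  case (While_True b ts c t1 ts1 t2 ts2)
  have "delta M a ss = Some (if b ss then Suc a else e, keep ss)" for ss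
    using While_True.prems[rule_format, of 0 ss] by simp
  with While_True.hyps(1) have "step M (a, ts) = (Suc a, ts)" by (simp add: map2_act_keep)
  moreover have "(step M ^^ t1) (Suc a, ts) = (a, ts1)"
  proof (rule While_True.IH(1), intro allI impI)
    fix i ss assume "i < num_instrs c"
    then show "delta M (Suc a + i) ss = Some ((compile (Suc a) a c ! i) ss)"
      using While_True.prems[rule_format, of "Suc i" ss] by simp
  qed
  moreover have "(step M ^^ t2) (a, ts1) = (e, ts2)"
    using While_True.IH(2) While_True.prems by blast
  ultimately have "(step M ^^ t2) ((step M ^^ t1) (step M (a, ts))) = (e, ts2)" by simp
  then show ?case
    by (simp add: add.commute[of t1] funpow_add funpow_swap1)
qed

text \<open>Recording only an upper bound on the time lets all rounds of a loop share one
  bound.\<close>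

definition runs :: "cmd \<Rightarrow> tape list \<Rightarrow> nat \<Rightarrow> tape list \<Rightarrow> bool" where
  "runs c ts T ts' \<longleftrightarrow> (\<exists>t \<le> T. big_step c ts t ts')"

lemma runs_mono: "runs c ts T ts' \<Longrightarrow> T \<le> T' \<Longrightarrow> runs c ts T' ts'"
  unfolding runs_def by (meson le_trans)

lemma runs_Do: "ts' = map2 act (f (map read_tape ts)) ts \<Longrightarrow> runs (Do f) ts 1 ts'"
  unfolding runs_def using big_step.Do by blast

lemma runs_Seq: "runs c ts T1 ts1 \<Longrightarrow> runs d ts1 T2 ts2 \<Longrightarrow> runs (Seq c d) ts (T1 + T2) ts2"
  unfolding runs_def by (meson add_mono big_step.Seq)

text \<open>\<open>S r\<close> is the configuration before round \<open>r\<close>. Each of the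
  \<open>N\<close> rounds pays one test and the body; the final 1 is the failing test.\<close>

lemma runs_While:
  assumes "\<And>r. r < N \<Longrightarrow> b (map read_tape (S r)) \<and> runs c (S r) T (S (Suc r))"
    and "\<not> b (map read_tape (S N))"
  shows "runs (While b c) (S 0) (N * (T + 1) + 1) (S N)"
  using assms
proof (induction N arbitrary: S)
  case 0
  have "big_step (While b c) (S 0) 1 (S 0)" using 0(2) by (rule big_step.While_False)
  then show ?case unfolding runs_def by auto
next
  case (Suc N)
  have "runs (While b c) (S (Suc 0)) (N * (T + 1) + 1) (S (Suc N))"
    using Suc.IH[of "\<lambda>r. S (Suc r)"] Suc.prems by simp
  then obtain t2 where t2: "t2 \<le> N * (T + 1) + 1" "big_step (While b c) (S (Suc 0)) t2 (S (Suc N))"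
    unfolding runs_def by blast
  obtain t1 where t1: "t1 \<le> T" "big_step c (S 0) t1 (S (Suc 0))"
    using Suc.prems(1)[of 0] unfolding runs_def by blast
  have "big_step (While b c) (S 0) (1 + t1 + t2) (S (Suc N))"
    using big_step.While_True t1 t2 Suc.prems(1)[of 0] by blast
  moreover have "1 + t1 + t2 \<le> Suc N * (T + 1) + 1" using t1(1) t2(1) by simp
  ultimately show ?case unfolding runs_def by blast
qed

lemma polytime_computableI:
  assumes "wf_cmd k c" "1 \<le> k"
    and runs: "\<And>x. \<exists>ts. runs c ((written x, 0) # replicate (k - 1) (\<lambda>_. 0, 0)) (poly p (length x)) ts \<and>
      fst (last ts) = written (f x)"
  shows "polytime_computable f"
  unfolding polytime_computable_def
proof (rule exI[of _ "machine k c"], rule exI[of _ p], intro conjI allI)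
  show "wf_tm (machine k c)" using wf_machine assms(1,2) .
next
  fix x
  let ?M = "machine k c"
  obtain ts t where t: "t \<le> poly p (length x)" and ts: "fst (last ts) = written (f x)"
    and big: "big_step c ((written x, 0) # replicate (k - 1) (\<lambda>_. 0, 0)) t ts"
    using runs[of x] unfolding runs_def by blast
  have run: "(step ?M ^^ t) (init_config ?M x) = (num_instrs c, ts)"
    using compile_run[OF big, of ?M 0 "num_instrs c"] by (simp add: machine_def init_config_def)
  show "\<exists>t\<le>poly p (length x). halted ?M ((step ?M ^^ t) (init_config ?M x)) \<and>
           has_output ((step ?M ^^ t) (init_config ?M x)) (f x)"
    by (rule exI[of _ t]) (simp add: run t ts has_output_def, simp add: machine_def)
qed

text \<open>On a single tape the input tape is also the output tape, so a machine that halts at once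
  computes the identity.\<close>

lemma polytime_computable_id: "polytime_computable (\<lambda>x. x)"
  unfolding polytime_computable_def
proof (intro exI conjI allI)
  let ?M = "\<lparr>num_tapes = 1, num_symbols = 3, num_states = 1, delta = (\<lambda>_ _. None)\<rparr>"
  show "wf_tm ?M" by (simp add: wf_tm_def)
  fix x :: "bool list"
  show "0 \<le> poly 0 (length x)" by simp
  show "halted ?M ((step ?M ^^ 0) (init_config ?M x))" by (simp add: init_config_def)
  show "has_output ((step ?M ^^ 0) (init_config ?M x)) x"
    by (simp add: init_config_def has_output_def)
qed

section \<open>Loops over a tape that holds a number in unary\<close>

definition move :: "dir list \<Rightarrow> cmd" where
  "move ds = Do (\<lambda>ss. map2 Pair ss ds)"

text \<open>The final rewinding undoes the effect of the moves \<open>up\<close>, given that \<open>down\<close> is inverse to it.\<close>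

definition For :: "nat \<Rightarrow> dir list \<Rightarrow> dir list \<Rightarrow> cmd \<Rightarrow> cmd" where
  "For r up down c =
     Seq (While (\<lambda>ss. ss ! r \<noteq> 0) (Seq c (move up)))
    (Seq (move down)
    (Seq (While (\<lambda>ss. ss ! r \<noteq> 0) (move down))
         (move up)))"

text \<open>The forward loop takes \<open>n * (T + 2) + 1\<close> steps, the rewinding loop
  \<open>n * 2 + 1\<close>, and the two single moves at the ends of the rewinding take 2.\<close>

definition for_time :: "nat \<Rightarrow> nat \<Rightarrow> nat" where
  "for_time n T = n * (T + 4) + 4"

text \<open>Blanks on both sides of the block let a head notice either end. \<open>ruler 1\<close>
  is the single mark at 0 against which index differences are tested.\<close>

definition ruler :: "nat \<Rightarrow> int \<Rightarrow> nat" where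
  "ruler n i = (if 0 \<le> i \<and> i < int n then 1 else 0)"

text \<open>\<open>F p a\<close> is the configuration with loop index \<open>p\<close> and remaining
  state \<open>a\<close>; the body takes state \<open>h i\<close> to \<open>h (Suc i)\<close>, while
  rewinding changes only the index. The index is an integer because rewinding passes through
  -1.\<close>

lemma runs_For:
  fixes F :: "int \<Rightarrow> 'h \<Rightarrow> tape list" and h :: "nat \<Rightarrow> 'h"
  assumes read: "\<And>p a. map read_tape (F p a) ! r = ruler n p"
    and up: "\<And>p a. runs (move up) (F p a) 1 (F (p + 1) a)"
    and down: "\<And>p a. runs (move down) (F p a) 1 (F (p - 1) a)"
    and body: "\<And>i. i < n \<Longrightarrow> runs c (F (int i) (h i)) T (F (int i) (h (Suc i)))"
  shows "runs (For r up down c) (F 0 (h 0)) (for_time n T) (F 0 (h n))"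
proof -
  have "runs (While (\<lambda>ss. ss ! r \<noteq> 0) (Seq c (move up))) (F (int 0) (h 0)) (n * (T + 1 + 1) + 1)
      (F (int n) (h n))"
  proof (rule runs_While)
    fix i assume i: "i < n"
    have "runs (Seq c (move up)) (F (int i) (h i)) (T + 1) (F (int i + 1) (h (Suc i)))"
      by (rule runs_Seq[OF body[OF i] up])
    then show "map read_tape (F (int i) (h i)) ! r \<noteq> 0 \<and>
       runs (Seq c (move up)) (F (int i) (h i)) (T + 1) (F (int (Suc i)) (h (Suc i)))"
      using i by (simp add: read ruler_def add.commute)
  qed (simp add: read ruler_def)
  moreover have "runs (While (\<lambda>ss. ss ! r \<noteq> 0) (move down)) (F (int n - 1 - int 0) (h n)) (n * (1 + 1) + 1)
      (F (int n - 1 - int n) (h n))"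
  proof (rule runs_While)
    fix i assume i: "i < n"
    have "runs (move down) (F (int n - 1 - int i) (h n)) 1 (F (int n - 1 - int i - 1) (h n))"
      by (rule down)
    then show "map read_tape (F (int n - 1 - int i) (h n)) ! r \<noteq> 0 \<and>
       runs (move down) (F (int n - 1 - int i) (h n)) 1 (F (int n - 1 - int (Suc i)) (h n))"
      using i by (simp add: read ruler_def algebra_simps)
  qed (simp add: read ruler_def)
  moreover have "runs (move down) (F (int n) (h n)) 1 (F (int n - 1 - int 0) (h n))"
    using down[of "int n" "h n"] by simp
  \<comment> \<open>Rewinding stops on the blank at -1, one cell too far.\<close>
  moreover have "runs (move up) (F (int n - 1 - int n) (h n)) 1 (F 0 (h n))"
    using up[of "-1" "h n"] by simp
  ultimately have "runs (For r up down c) (F (int 0) (h 0))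
      (n * (T + 1 + 1) + 1 + (1 + (n * (1 + 1) + 1 + 1))) (F 0 (h n))"
    unfolding For_def by (blast intro: runs_Seq)
  then show ?thesis unfolding of_nat_0 by (rule runs_mono) (simp add: for_time_def algebra_simps)
qed

section \<open>The constructed graph\<close>

text \<open>
  For \<open>s > 0\<close>, the triple \<open>(i, j, s)\<close> is an edge of an auxiliary graph on pairs, where \<open>(i, i)\<close> stands
  for the vertex \<open>i\<close> and \<open>(i, j)\<close> for the subdivision vertex of an arc from \<open>i\<close> to \<open>j\<close>: the triples with
  \<open>s = 1\<close> and \<open>s = 2\<close> are the two halves of the arc, and \<open>(i, i, 3)\<close> is a half-edge that marks \<open>(i, i)\<close>.
\<close>

fun incident :: "(nat \<Rightarrow> nat \<Rightarrow> bool) \<Rightarrow> nat \<times> nat \<Rightarrow> nat \<times> nat \<times> nat \<Rightarrow> bool" where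
  "incident A (k, l) (i, j, s) \<longleftrightarrow>
     (if s = 1 then A i j \<and> k = i \<and> (l = j \<or> l = i)
      else if s = 2 then A i j \<and> l = j \<and> (k = i \<or> k = j)
      else k = i \<and> l = j \<and> i = j)"

text \<open>Last coordinate 0 marks the vertex side, where the triple stands for its pair; the other
  values mark the edge side. A triple on the edge side whose arc or half-edge is absent is incident
  with nothing, hence adjacent to the whole vertex side.\<close>

fun adj :: "(nat \<Rightarrow> nat \<Rightarrow> bool) \<Rightarrow> nat \<times> nat \<times> nat \<Rightarrow> nat \<times> nat \<times> nat \<Rightarrow> bool" where
  "adj A (i, j, s) (k, l, t) \<longleftrightarrow>
     (s = 0 \<and> t \<noteq> 0 \<and> \<not> incident A (i, j) (k, l, t)) \<or>
     (t = 0 \<and> s \<noteq> 0 \<and> \<not> incident A (k, l) (i, j, s))"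

declare incident.simps [simp del] adj.simps [simp del]

definition graph_row :: "nat \<Rightarrow> (nat \<Rightarrow> nat \<Rightarrow> bool) \<Rightarrow> nat \<times> nat \<times> nat \<Rightarrow> bool list" where
  "graph_row n A u =
     concat (map (\<lambda>k. concat (map (\<lambda>l. map (\<lambda>t. adj A u (k, l, t)) [0..<4]) [0..<n])) [0..<n])"

definition graph_code :: "nat \<Rightarrow> (nat \<Rightarrow> nat \<Rightarrow> bool) \<Rightarrow> bool list" where
  "graph_code n A =
     replicate (4 * (n * n)) True @ [False] @
     concat (map (\<lambda>i. concat (map (\<lambda>j. concat (map (\<lambda>s. graph_row n A (i, j, s)) [0..<4]))
       [0..<n])) [0..<n])"

section \<open>The machine\<close>

text \<open>
  Tapes 0 and 1 hold the input, tapes 2 to 5 are rulers for the loop indices \<open>i, j, k, l\<close>. Tapes 6 to 9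
  have a single mark at 0 and their heads at the differences of two indices, so that equality of
  the indices can be read off. Tape 10 is the output.
\<close>

definition conf :: "(int \<Rightarrow> nat) \<Rightarrow> nat \<Rightarrow> int \<Rightarrow> int \<Rightarrow> int \<Rightarrow> int \<Rightarrow> int \<Rightarrow> int \<Rightarrow> bool list \<Rightarrow> tape list" where
  "conf X n p q i j k l out =
     [(X, p), (X, q), (ruler n, i), (ruler n, j), (ruler n, k), (ruler n, l),
      (ruler 1, i - k), (ruler 1, j - l), (ruler 1, i - l), (ruler 1, j - k),
      (written out, int (length out))]"

abbreviation (input) "Lt \<equiv> Move_Left"
abbreviation (input) "Rt \<equiv> Move_Right"
abbreviation (input) "St \<equiv> Stay"

text \<open>Besides its ruler, each loop shifts the two difference tapes in which its index occurs,
  in the opposite direction where the index is subtracted. So equality of indices is maintained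
  without arithmetic.\<close>

definition for_i :: "cmd \<Rightarrow> cmd" where
  "for_i = For 2 [St, St, Rt, St, St, St, Rt, St, Rt, St, St] [St, St, Lt, St, St, St, Lt, St, Lt, St, St]"

definition for_j :: "cmd \<Rightarrow> cmd" where
  "for_j = For 3 [St, St, St, Rt, St, St, St, Rt, St, Rt, St] [St, St, St, Lt, St, St, St, Lt, St, Lt, St]"

definition for_k :: "cmd \<Rightarrow> cmd" where
  "for_k = For 4 [St, St, St, St, Rt, St, Lt, St, St, Lt, St] [St, St, St, St, Lt, St, Rt, St, St, Rt, St]"

definition for_l :: "cmd \<Rightarrow> cmd" where
  "for_l = For 5 [St, St, St, St, St, Rt, St, Lt, Lt, St, St] [St, St, St, St, St, Lt, St, Rt, Rt, St, St]"

lemma runs_move: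
  assumes "length ds = length ts" "ts' = map2 (\<lambda>d (c, p). (c, p + offset d)) ds ts"
  shows "runs (move ds) ts 1 ts'"
  unfolding move_def
proof (rule runs_Do)
  show "ts' = map2 act (map2 Pair (map read_tape ts) ds) ts"
    unfolding assms(2) using assms(1) by (induction ds ts rule: list_induct2) auto
qed

text \<open>The state passed between rounds consists of the two input head positions and the output
  so far, given by the sequences \<open>p\<close>, \<open>q\<close> and \<open>out\<close>.\<close>

lemma runs_for_i:
  assumes "\<And>i. i < n \<Longrightarrow> runs c (conf X n (p i) (q i) (int i) j k l (out i)) T
      (conf X n (p (Suc i)) (q (Suc i)) (int i) j k l (out (Suc i)))"
  shows "runs (for_i c) (conf X n (p 0) (q 0) 0 j k l (out 0)) (for_time n T)
      (conf X n (p n) (q n) 0 j k l (out n))"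
proof -
  let ?F = "\<lambda>i h. conf X n (fst h) (fst (snd h)) i j k l (snd (snd h))"
  let ?h = "\<lambda>i. (p i, q i, out i)"
  have "runs (for_i c) (?F 0 (?h 0)) (for_time n T) (?F 0 (?h n))"
    unfolding for_i_def
  proof (rule runs_For[where F = ?F and h = ?h], goal_cases)
    case 1
    show ?case by (simp add: conf_def)
  next
    case 2
    show ?case by (rule runs_move) (simp_all add: conf_def)
  next
    case 3
    show ?case by (rule runs_move) (simp_all add: conf_def)
  qed (simp add: assms)
  then show ?thesis by simp
qed

lemma runs_for_j:
  assumes "\<And>j. j < n \<Longrightarrow> runs c (conf X n (p j) (q j) i (int j) k l (out j)) T
      (conf X n (p (Suc j)) (q (Suc j)) i (int j) k l (out (Suc j)))"
  shows "runs (for_j c) (conf X n (p 0) (q 0) i 0 k l (out 0)) (for_time n T)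
      (conf X n (p n) (q n) i 0 k l (out n))"
proof -
  let ?F = "\<lambda>j h. conf X n (fst h) (fst (snd h)) i j k l (snd (snd h))"
  let ?h = "\<lambda>i. (p i, q i, out i)"
  have "runs (for_j c) (?F 0 (?h 0)) (for_time n T) (?F 0 (?h n))"
    unfolding for_j_def
  proof (rule runs_For[where F = ?F and h = ?h], goal_cases)
    case 1
    show ?case by (simp add: conf_def)
  next
    case 2
    show ?case by (rule runs_move) (simp_all add: conf_def)
  next
    case 3
    show ?case by (rule runs_move) (simp_all add: conf_def)
  qed (simp add: assms)
  then show ?thesis by simp
qed

lemma runs_for_k:
  assumes "\<And>k. k < n \<Longrightarrow> runs c (conf X n (p k) (q k) i j (int k) l (out k)) T
      (conf X n (p (Suc k)) (q (Suc k)) i j (int k) l (out (Suc k)))"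
  shows "runs (for_k c) (conf X n (p 0) (q 0) i j 0 l (out 0)) (for_time n T)
      (conf X n (p n) (q n) i j 0 l (out n))"
proof -
  let ?F = "\<lambda>k h. conf X n (fst h) (fst (snd h)) i j k l (snd (snd h))"
  let ?h = "\<lambda>i. (p i, q i, out i)"
  have "runs (for_k c) (?F 0 (?h 0)) (for_time n T) (?F 0 (?h n))"
    unfolding for_k_def
  proof (rule runs_For[where F = ?F and h = ?h], goal_cases)
    case 1
    show ?case by (simp add: conf_def)
  next
    case 2
    show ?case by (rule runs_move) (simp_all add: conf_def)
  next
    case 3
    show ?case by (rule runs_move) (simp_all add: conf_def)
  qed (simp add: assms)
  then show ?thesis by simp
qed

lemma runs_for_l:
  assumes "\<And>l. l < n \<Longrightarrow> runs c (conf X n (p l) (q l) i j k (int l) (out l)) T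
      (conf X n (p (Suc l)) (q (Suc l)) i j k (int l) (out (Suc l)))"
  shows "runs (for_l c) (conf X n (p 0) (q 0) i j k 0 (out 0)) (for_time n T)
      (conf X n (p n) (q n) i j k 0 (out n))"
proof -
  let ?F = "\<lambda>l h. conf X n (fst h) (fst (snd h)) i j k l (snd (snd h))"
  let ?h = "\<lambda>i. (p i, q i, out i)"
  have "runs (for_l c) (?F 0 (?h 0)) (for_time n T) (?F 0 (?h n))"
    unfolding for_l_def
  proof (rule runs_For[where F = ?F and h = ?h], goal_cases)
    case 1
    show ?case by (simp add: conf_def)
  next
    case 2
    show ?case by (rule runs_move) (simp_all add: conf_def)
  next
    case 3
    show ?case by (rule runs_move) (simp_all add: conf_def)
  qed (simp add: assms)
  then show ?thesis by simp
qed

section \<open>Printing the adjacency matrix and its unary header\<close>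

definition emit :: "(nat list \<Rightarrow> bool) \<Rightarrow> cmd" where
  "emit b = Do (\<lambda>ss. keep (take 10 ss) @ [(if b ss then 2 else 1, Rt)])"

lemma written_snoc: "(written out)(int (length out) := if b then 2 else 1) = written (out @ [b])"
  by (auto simp: written_def fun_eq_iff nth_append nat_less_iff)

lemma runs_emit:
  assumes "b (map read_tape (conf X n p q i j k l out)) = v"
  shows "runs (emit b) (conf X n p q i j k l out) 1 (conf X n p q i j k l (out @ [v]))"
  unfolding emit_def
  by (rule runs_Do) (unfold assms, simp add: conf_def keep_def written_snoc[symmetric])

text \<open>This is \<open>adj\<close> as a test on scanned symbols. No tape compares
  \<open>i\<close> with \<open>j\<close> or \<open>k\<close> with \<open>l\<close>; in the half-edge
  case the two other equalities make \<open>i = l\<close> equivalent to the missing one.\<close>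

definition entry :: "nat \<Rightarrow> nat \<Rightarrow> nat list \<Rightarrow> bool" where
  "entry s t ss \<longleftrightarrow>
     (let ij = (ss ! 0 = 2); kl = (ss ! 1 = 2);
        ik = (ss ! 6 \<noteq> 0); jl = (ss ! 7 \<noteq> 0); il = (ss ! 8 \<noteq> 0); jk = (ss ! 9 \<noteq> 0)
      in s = 0 \<and> t \<noteq> 0 \<and>
           \<not> (if t = 1 then kl \<and> ik \<and> (jl \<or> jk) else if t = 2 then kl \<and> jl \<and> (ik \<or> il) else ik \<and> jl \<and> il) \<or>
         t = 0 \<and> s \<noteq> 0 \<and>
           \<not> (if s = 1 then ij \<and> ik \<and> (jl \<or> il) else if s = 2 then ij \<and> jl \<and> (ik \<or> jk) else ik \<and> jl \<and> il))"

lemma entry_conf: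
  assumes "A i j \<longleftrightarrow> X p = 2" "A k l \<longleftrightarrow> X q = 2"
  shows "entry s t (map read_tape (conf X n p q (int i) (int j) (int k) (int l) out)) =
    adj A (i, j, s) (k, l, t)"
proof -
  have r: "ruler 1 (int a - int b) = 0 \<longleftrightarrow> a \<noteq> b" for a b
    by (auto simp: ruler_def)
  let ?ss = "map read_tape (conf X n p q (int i) (int j) (int k) (int l) out)"
  have reads: "?ss ! 0 = X p" "?ss ! 1 = X q"
    "?ss ! 6 = ruler 1 (int i - int k)" "?ss ! 7 = ruler 1 (int j - int l)"
    "?ss ! 8 = ruler 1 (int i - int l)" "?ss ! 9 = ruler 1 (int j - int k)"
    by (simp_all add: conf_def)
  have "entry s t (map read_tape (conf X n p q (int i) (int j) (int k) (int l) out)) \<longleftrightarrow>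
    s = 0 \<and> t \<noteq> 0 \<and>
       \<not> (if t = 1 then A k l \<and> i = k \<and> (j = l \<or> j = k)
          else if t = 2 then A k l \<and> j = l \<and> (i = k \<or> i = l) else i = k \<and> j = l \<and> i = l) \<or>
    t = 0 \<and> s \<noteq> 0 \<and>
       \<not> (if s = 1 then A i j \<and> i = k \<and> (j = l \<or> i = l)
          else if s = 2 then A i j \<and> j = l \<and> (i = k \<or> j = k) else i = k \<and> j = l \<and> i = l)"
    unfolding entry_def Let_def assms reads r by (simp only: not_not)
  then show ?thesis
    by (cases "s = 0"; cases "t = 0") (auto simp: adj.simps incident.simps)
qed

definition move_in :: "dir \<Rightarrow> cmd" where
  "move_in d = move [d, St, St, St, St, St, St, St, St, St, St]"

definition move_copy :: "dir \<Rightarrow> cmd" where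
  "move_copy d = move [St, d, St, St, St, St, St, St, St, St, St]"

lemma runs_move_in: "runs (move_in d) (conf X n p q i j k l out) 1 (conf X n (p + offset d) q i j k l out)"
  unfolding move_in_def by (rule runs_move) (auto simp: conf_def)

lemma runs_move_copy: "runs (move_copy d) (conf X n p q i j k l out) 1 (conf X n p (q + offset d) i j k l out)"
  unfolding move_copy_def by (rule runs_move) (auto simp: conf_def)

text \<open>One row of the output scans the whole input matrix with the second head. The start of
  the matrix carries no mark, so a second pair of loops brings this head back by counting
  \<open>n * n\<close> moves to the left.\<close>

definition row_cmd :: "nat \<Rightarrow> cmd" where
  "row_cmd s =
     Seq (for_k (for_l
       (Seq (Seq (emit (entry s 0)) (Seq (emit (entry s 1)) (Seq (emit (entry s 2)) (emit (entry s 3)))))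
            (move_copy Rt))))
     (for_k (for_l (move_copy Lt)))"

definition row_time :: "nat \<Rightarrow> nat" where
  "row_time n = for_time n (for_time n 5) + for_time n (for_time n 1)"

lemma upt_4: "[0..<4] = [0, 1, 2, 3::nat]"
  by (simp add: upt_rec)

lemma runs_row_cmd:
  assumes A: "\<And>k l. k < n \<Longrightarrow> l < n \<Longrightarrow> A k l \<longleftrightarrow> X (q + int (k * n + l)) = 2"
    and ij: "A i j \<longleftrightarrow> X p = 2"
  shows "runs (row_cmd s) (conf X n p q (int i) (int j) 0 0 out) (row_time n)
    (conf X n p q (int i) (int j) 0 0 (out @ graph_row n A (i, j, s)))"
proof -
  let ?g = "\<lambda>k l. map (\<lambda>t. adj A (i, j, s) (k, l, t)) [0..<4]"
  let ?f = "\<lambda>k. concat (map (?g k) [0..<n])"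
  let ?c = "Seq (Seq (emit (entry s 0)) (Seq (emit (entry s 1)) (Seq (emit (entry s 2)) (emit (entry s 3)))))
            (move_copy Rt)"
  have cell: "runs ?c (conf X n p (q + int (k * n + l)) (int i) (int j) (int k) (int l) out) 5
     (conf X n p (q + int (k * n + Suc l)) (int i) (int j) (int k) (int l) (out @ ?g k l))"
    if "k < n" "l < n" for k l out
  proof -
    have e: "runs (emit (entry s t)) (conf X n p (q + int (k * n + l)) (int i) (int j) (int k) (int l) out) 1
       (conf X n p (q + int (k * n + l)) (int i) (int j) (int k) (int l) (out @ [adj A (i, j, s) (k, l, t)]))" for t out
      by (rule runs_emit, rule entry_conf[where A = A], rule ij, rule A[OF that])
    have m: "runs (move_copy Rt) (conf X n p (q + int (k * n + l)) (int i) (int j) (int k) (int l) out) 1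
       (conf X n p (q + int (k * n + Suc l)) (int i) (int j) (int k) (int l) out)" for out
      using runs_move_copy[of Rt X n p "q + int (k * n + l)"] by (simp add: ac_simps)
    have "runs ?c (conf X n p (q + int (k * n + l)) (int i) (int j) (int k) (int l) out) ((1 + (1 + (1 + 1))) + 1)
     (conf X n p (q + int (k * n + Suc l)) (int i) (int j) (int k) (int l)
        ((((out @ [adj A (i, j, s) (k, l, 0)]) @ [adj A (i, j, s) (k, l, 1)]) @ [adj A (i, j, s) (k, l, 2)])
          @ [adj A (i, j, s) (k, l, 3)]))"
      by (intro runs_Seq[OF _ m] runs_Seq[OF e] e)
    then show ?thesis by (simp add: upt_4 numeral_eq_Suc)
  qed
  have line: "runs (for_l ?c) (conf X n p (q + int (k * n)) (int i) (int j) (int k) 0 out) (for_time n 5)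
     (conf X n p (q + int (Suc k * n)) (int i) (int j) (int k) 0 (out @ ?f k))"
    if "k < n" for k out
  proof -
    have "runs ?c (conf X n p (q + int (k * n + l)) (int i) (int j) (int k) (int l) (out @ concat (map (?g k) [0..<l]))) 5
       (conf X n p (q + int (k * n + Suc l)) (int i) (int j) (int k) (int l) (out @ concat (map (?g k) [0..<Suc l])))"
      if "l < n" for l
      using cell[OF \<open>k < n\<close> that, of "out @ concat (map (?g k) [0..<l])"] by simp
    from runs_for_l[where q = "\<lambda>l. q + int (k * n + l)" and out = "\<lambda>l. out @ concat (map (?g k) [0..<l])", OF this]
    show ?thesis by (simp add: add.commute)
  qed
  have "runs (for_k (for_l ?c)) (conf X n p q (int i) (int j) 0 0 out) (for_time n (for_time n 5))
     (conf X n p (q + int (n * n)) (int i) (int j) 0 0 (out @ graph_row n A (i, j, s)))"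
  proof -
    have "runs (for_l ?c) (conf X n p (q + int (k * n)) (int i) (int j) (int k) 0 (out @ concat (map ?f [0..<k]))) (for_time n 5)
       (conf X n p (q + int (Suc k * n)) (int i) (int j) (int k) 0 (out @ concat (map ?f [0..<Suc k])))"
      if "k < n" for k
      using line[OF that, of "out @ concat (map ?f [0..<k])"] by simp
    from runs_for_k[where q = "\<lambda>k. q + int (k * n)" and out = "\<lambda>k. out @ concat (map ?f [0..<k])", OF this]
    show ?thesis by (simp add: graph_row_def)
  qed
  moreover
  have line: "runs (for_l (move_copy Lt)) (conf X n p (q' - int (k * n)) i' j' (int k) 0 out) (for_time n 1)
     (conf X n p (q' - int (Suc k * n)) i' j' (int k) 0 out)" for k out q' i' j'
  proof -
    have "runs (move_copy Lt) (conf X n p (q' - int (k * n + l)) i' j' (int k) (int l) out) 1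
       (conf X n p (q' - int (k * n + Suc l)) i' j' (int k) (int l) out)" for l
      using runs_move_copy[of Lt X n p "q' - int (k * n + l)"] by (simp add: algebra_simps)
    from runs_for_l[where q = "\<lambda>l. q' - int (k * n + l)" and out = "\<lambda>_. out", OF this]
    show ?thesis by (simp add: add.commute)
  qed
  have "runs (for_k (for_l (move_copy Lt))) (conf X n p q' i' j' 0 0 out) (for_time n (for_time n 1))
     (conf X n p (q' - int (n * n)) i' j' 0 0 out)" for q' i' j' out
    using runs_for_k[where q = "\<lambda>k. q' - int (k * n)" and out = "\<lambda>_. out", OF line] by simp
  from this[of "q + int (n * n)"]
  have "runs (for_k (for_l (move_copy Lt))) (conf X n p (q + int (n * n)) i' j' 0 0 out) (for_time n (for_time n 1))
     (conf X n p q i' j' 0 0 out)" for i' j' out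
    by simp
  ultimately show ?thesis unfolding row_cmd_def row_time_def by (rule runs_Seq)
qed

text \<open>The four triples over one pair \<open>(i, j)\<close> depend on the same input entry, so
  the first head advances only after four rows.\<close>

definition matrix_cmd :: cmd where
  "matrix_cmd =
     for_i (for_j (Seq (row_cmd 0) (Seq (row_cmd 1) (Seq (row_cmd 2) (Seq (row_cmd 3) (move_in Rt))))))"

definition matrix_time :: "nat \<Rightarrow> nat" where
  "matrix_time n = for_time n (for_time n (4 * row_time n + 1))"

lemma runs_matrix_cmd:
  fixes n p X
  defines "A \<equiv> \<lambda>i j. X (p + int (i * n + j)) = 2"
  shows "runs matrix_cmd (conf X n p p 0 0 0 0 out) (matrix_time n)
    (conf X n (p + int (n * n)) p 0 0 0 0 (out @
       concat (map (\<lambda>i. concat (map (\<lambda>j. concat (map (\<lambda>s. graph_row n A (i, j, s)) [0..<4])) [0..<n])) [0..<n])))"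
proof -
  let ?g = "\<lambda>i j. concat (map (\<lambda>s. graph_row n A (i, j, s)) [0..<4])"
  let ?f = "\<lambda>i. concat (map (?g i) [0..<n])"
  let ?c = "Seq (row_cmd 0) (Seq (row_cmd 1) (Seq (row_cmd 2) (Seq (row_cmd 3) (move_in Rt))))"
  have cell: "runs ?c (conf X n (p + int (i * n + j)) p (int i) (int j) 0 0 out) (4 * row_time n + 1)
     (conf X n (p + int (i * n + Suc j)) p (int i) (int j) 0 0 (out @ ?g i j))" for i j out
  proof -
    have r: "runs (row_cmd s) (conf X n (p + int (i * n + j)) p (int i) (int j) 0 0 out) (row_time n)
       (conf X n (p + int (i * n + j)) p (int i) (int j) 0 0 (out @ graph_row n A (i, j, s)))" for s out
      by (rule runs_row_cmd) (simp_all add: A_def)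
    have m: "runs (move_in Rt) (conf X n (p + int (i * n + j)) p (int i) (int j) 0 0 out) 1
       (conf X n (p + int (i * n + Suc j)) p (int i) (int j) 0 0 out)" for out
      using runs_move_in[of Rt X n "p + int (i * n + j)"] by (simp add: ac_simps)
    have "runs ?c (conf X n (p + int (i * n + j)) p (int i) (int j) 0 0 out)
       (row_time n + (row_time n + (row_time n + (row_time n + 1))))
     (conf X n (p + int (i * n + Suc j)) p (int i) (int j) 0 0
       ((((out @ graph_row n A (i, j, 0)) @ graph_row n A (i, j, 1)) @ graph_row n A (i, j, 2)) @ graph_row n A (i, j, 3)))"
      by (intro runs_Seq[OF r] m)
    then show ?thesis by (simp add: upt_4 numeral_eq_Suc)
  qed
  have line: "runs (for_j ?c) (conf X n (p + int (i * n)) p (int i) 0 0 0 out) (for_time n (4 * row_time n + 1))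
     (conf X n (p + int (Suc i * n)) p (int i) 0 0 0 (out @ ?f i))" for i out
  proof -
    have "runs ?c (conf X n (p + int (i * n + j)) p (int i) (int j) 0 0 (out @ concat (map (?g i) [0..<j]))) (4 * row_time n + 1)
       (conf X n (p + int (i * n + Suc j)) p (int i) (int j) 0 0 (out @ concat (map (?g i) [0..<Suc j])))" for j
      using cell[of i j "out @ concat (map (?g i) [0..<j])"] by simp
    from runs_for_j[where p = "\<lambda>j. p + int (i * n + j)" and out = "\<lambda>j. out @ concat (map (?g i) [0..<j])", OF this]
    show ?thesis by (simp add: add.commute)
  qed
  have "runs (for_j ?c) (conf X n (p + int (i * n)) p (int i) 0 0 0 (out @ concat (map ?f [0..<i]))) (for_time n (4 * row_time n + 1))
     (conf X n (p + int (Suc i * n)) p (int i) 0 0 0 (out @ concat (map ?f [0..<Suc i])))" for i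
    using line[of i "out @ concat (map ?f [0..<i])"] by simp
  from runs_for_i[where p = "\<lambda>i. p + int (i * n)" and out = "\<lambda>i. out @ concat (map ?f [0..<i])", OF this]
  show ?thesis by (simp add: matrix_cmd_def matrix_time_def)
qed

definition header_cmd :: cmd where
  "header_cmd =
     Seq (for_i (for_j (Seq (emit (\<lambda>_. True)) (Seq (emit (\<lambda>_. True)) (Seq (emit (\<lambda>_. True)) (emit (\<lambda>_. True)))))))
         (emit (\<lambda>_. False))"

definition header_time :: "nat \<Rightarrow> nat" where
  "header_time n = for_time n (for_time n 4) + 1"

lemma runs_header_cmd:
  "runs header_cmd (conf X n p q 0 0 0 0 out) (header_time n)
    (conf X n p q 0 0 0 0 (out @ replicate (4 * (n * n)) True @ [False]))"
proof -
  let ?c = "Seq (emit (\<lambda>_. True)) (Seq (emit (\<lambda>_. True)) (Seq (emit (\<lambda>_. True)) (emit (\<lambda>_. True))))"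
  have e: "runs (emit (\<lambda>_. b)) (conf X n p q i j k l out) 1 (conf X n p q i j k l (out @ [b]))" for b i j k l out
    by (rule runs_emit) simp
  have "runs ?c (conf X n p q i j k l out) (1 + (1 + (1 + 1)))
     (conf X n p q i j k l ((((out @ [True]) @ [True]) @ [True]) @ [True]))" for i j k l out
    by (intro runs_Seq[OF e] e)
  moreover have "1 + (1 + (1 + 1)) = (4 :: nat)" by simp
  moreover have "replicate 4 True = [True, True, True, True]" by (simp add: numeral_eq_Suc)
  ultimately have cell: "runs ?c (conf X n p q i j k l out) 4 (conf X n p q i j k l (out @ replicate 4 True))"
    for i j k l out
    by (simp only: append_assoc append_Cons append_Nil)
  have line: "runs (for_j ?c) (conf X n p q i 0 0 0 (out @ replicate (4 * (a * n)) True)) (for_time n 4)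
     (conf X n p q i 0 0 0 (out @ replicate (4 * (Suc a * n)) True))" for i a out
  proof -
    have "runs ?c (conf X n p q i (int j) 0 0 (out @ replicate (4 * (a * n + j)) True)) 4
       (conf X n p q i (int j) 0 0 (out @ replicate (4 * (a * n + Suc j)) True))" for j
    proof -
      have eq: "(out @ replicate (4 * (a * n + j)) True) @ replicate 4 True = out @ replicate (4 * (a * n + Suc j)) True"
      proof -
        have "4 * (a * n + Suc j) = 4 * (a * n + j) + 4" by simp
        then show ?thesis by (simp only: replicate_add append_assoc)
      qed
      show ?thesis by (rule cell[of i "int j" 0 0 "out @ replicate (4 * (a * n + j)) True", unfolded eq])
    qed
    from runs_for_j[where p = "\<lambda>_. p" and q = "\<lambda>_. q" and out = "\<lambda>j. out @ replicate (4 * (a * n + j)) True", OF this]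
    moreover have "4 * (Suc a * n) = 4 * (a * n + n)" by simp
    ultimately show ?thesis by (simp only: add_0_right)
  qed
  have "runs (for_i (for_j ?c)) (conf X n p q 0 0 0 0 out) (for_time n (for_time n 4))
    (conf X n p q 0 0 0 0 (out @ replicate (4 * (n * n)) True))"
    using runs_for_i[where p = "\<lambda>_. p" and q = "\<lambda>_. q" and out = "\<lambda>i. out @ replicate (4 * (i * n)) True", OF line]
    by (simp only: mult_0 mult_0_right replicate_0 append_Nil2)
  then have "runs header_cmd (conf X n p q 0 0 0 0 out) (header_time n)
    (conf X n p q 0 0 0 0 ((out @ replicate (4 * (n * n)) True) @ [False]))"
    unfolding header_cmd_def header_time_def using e by (rule runs_Seq)
  then show ?thesis by simp
qed

section \<open>Reading and erasing the number of vertices\<close>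

definition move_rulers :: "dir \<Rightarrow> cmd" where
  "move_rulers d = move [St, St, d, d, d, d, St, St, St, St, St]"

text \<open>All four indices change together, so their differences are unchanged and tapes 6 to 9
  stay still.\<close>

lemma runs_move_rulers:
  "runs (move_rulers d) (conf X n p q i i i i out) 1
    (conf X n p q (i + offset d) (i + offset d) (i + offset d) (i + offset d) out)"
  unfolding move_rulers_def by (rule runs_move) (simp_all add: conf_def)

text \<open>With \<open>v = 1\<close> and moves to the right this copies the unary prefix of the
  input to the rulers; with \<open>v = 0\<close> and moves to the left it wipes them.\<close>

definition write_rulers :: "nat \<Rightarrow> dir \<Rightarrow> dir \<Rightarrow> cmd" where
  "write_rulers v d e =
     Do (\<lambda>ss. map (\<lambda>s. (s, d)) (take 2 ss) @ replicate 4 (v, e) @ keep (drop 6 ss))"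

lemma runs_write_rulers:
  assumes "(ruler n)(i := v) = ruler n'"
  shows "runs (write_rulers v d e) (conf X n p q i i i i out) 1
    (conf X n' (p + offset d) (q + offset d) (i + offset e) (i + offset e) (i + offset e) (i + offset e) out)"
proof -
  have "replicate 4 (v, e) = [(v, e), (v, e), (v, e), (v, e)]" by (simp add: numeral_eq_Suc)
  then show ?thesis
    unfolding write_rulers_def by (intro runs_Do) (simp add: conf_def keep_def assms)
qed

text \<open>The move between the two loops steps over the terminator of the unary prefix while the
  ruler heads turn back onto their last mark.\<close>

definition parse_cmd :: cmd where
  "parse_cmd =
     Seq (While (\<lambda>ss. ss ! 0 = 2) (write_rulers 1 Rt Rt))
    (Seq (move [Rt, Rt, Lt, Lt, Lt, Lt, St, St, St, St, St])
    (Seq (While (\<lambda>ss. ss ! 2 \<noteq> 0) (move_rulers Lt))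
         (move_rulers Rt)))"

lemma runs_parse_cmd:
  assumes "\<And>r. r < n \<Longrightarrow> X (p + int r) = 2" "X (p + int n) \<noteq> 2"
  shows "runs parse_cmd (conf X 0 p p 0 0 0 0 out) (4 * n + 4)
    (conf X n (p + int n + 1) (p + int n + 1) 0 0 0 0 out)"
proof -
  let ?S = "\<lambda>r. conf X r (p + int r) (p + int r) (int r) (int r) (int r) (int r) out"
  have "runs (While (\<lambda>ss. ss ! 0 = 2) (write_rulers 1 Rt Rt)) (?S 0) (n * (1 + 1) + 1) (?S n)"
  proof (rule runs_While)
    fix r assume "r < n"
    have "(ruler r)(int r := 1) = ruler (Suc r)" by (auto simp: ruler_def fun_eq_iff)
    from runs_write_rulers[OF this, of Rt Rt X "p + int r" "p + int r" out] assms(1)[OF \<open>r < n\<close>]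
    show "map read_tape (?S r) ! 0 = 2 \<and> runs (write_rulers 1 Rt Rt) (?S r) 1 (?S (Suc r))"
      by (simp add: ac_simps) (simp add: conf_def)
  next
    show "map read_tape (?S n) ! 0 \<noteq> 2" using assms(2) by (simp add: conf_def)
  qed
  moreover
  let ?P = "p + int n + 1"
  let ?R = "\<lambda>r. let i = int n - 1 - int r in conf X n ?P ?P i i i i out"
  have "runs (move [Rt, Rt, Lt, Lt, Lt, Lt, St, St, St, St, St]) (?S n) 1 (?R 0)"
    by (rule runs_move) (simp_all add: conf_def Let_def)
  moreover have "runs (While (\<lambda>ss. ss ! 2 \<noteq> 0) (move_rulers Lt)) (?R 0) (n * (1 + 1) + 1) (?R n)"
  proof (rule runs_While)
    fix r assume "r < n"
    then show "map read_tape (?R r) ! 2 \<noteq> 0 \<and> runs (move_rulers Lt) (?R r) 1 (?R (Suc r))"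
      using runs_move_rulers[of Lt X n ?P ?P "int n - 1 - int r" out]
      by (simp add: algebra_simps Let_def) (simp add: conf_def ruler_def)
  qed (simp add: conf_def ruler_def Let_def)
  moreover have "runs (move_rulers Rt) (?R n) 1 (conf X n ?P ?P 0 0 0 0 out)"
    using runs_move_rulers[of Rt X n ?P ?P "-1" out] by (simp add: Let_def)
  ultimately have "runs parse_cmd (?S 0) ((n * (1 + 1) + 1) + (1 + ((n * (1 + 1) + 1) + 1)))
    (conf X n ?P ?P 0 0 0 0 out)"
    unfolding parse_cmd_def by (blast intro: runs_Seq)
  then have "runs parse_cmd (?S 0) (4 * n + 4) (conf X n ?P ?P 0 0 0 0 out)"
    by (rule runs_mono) simp
  then show ?thesis by simp
qed

text \<open>The second graph may have fewer vertices than the first, so the old rulers must be wiped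
  before new ones are written.\<close>

definition erase_cmd :: cmd where
  "erase_cmd =
     Seq (While (\<lambda>ss. ss ! 2 \<noteq> 0) (move_rulers Rt))
    (Seq (move_rulers Lt)
    (Seq (While (\<lambda>ss. ss ! 2 \<noteq> 0) (write_rulers 0 St Lt))
         (move_rulers Rt)))"

lemma runs_erase_cmd:
  "runs erase_cmd (conf X n p q 0 0 0 0 out) (4 * n + 4) (conf X 0 p q 0 0 0 0 out)"
proof -
  let ?S = "\<lambda>r. conf X n p q (int r) (int r) (int r) (int r) out"
  have "runs (While (\<lambda>ss. ss ! 2 \<noteq> 0) (move_rulers Rt)) (?S 0) (n * (1 + 1) + 1) (?S n)"
  proof (rule runs_While)
    fix r assume "r < n"
    then show "map read_tape (?S r) ! 2 \<noteq> 0 \<and> runs (move_rulers Rt) (?S r) 1 (?S (Suc r))"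
      using runs_move_rulers[of Rt X n p q "int r" out]
      by (simp add: ac_simps) (simp add: conf_def ruler_def)
  qed (simp add: conf_def ruler_def Let_def)
  moreover
  let ?R = "\<lambda>r. let i = int n - 1 - int r in conf X (n - r) p q i i i i out"
  have "runs (move_rulers Lt) (?S n) 1 (?R 0)"
    using runs_move_rulers[of Lt X n p q "int n" out] by (simp add: Let_def)
  moreover have "runs (While (\<lambda>ss. ss ! 2 \<noteq> 0) (write_rulers 0 St Lt)) (?R 0) (n * (1 + 1) + 1) (?R n)"
  proof (rule runs_While)
    fix r assume "r < n"
    then have "(ruler (n - r))(int n - 1 - int r := 0) = ruler (n - Suc r)"
      by (auto simp: ruler_def fun_eq_iff)
    from runs_write_rulers[OF this, of St Lt X p q out] \<open>r < n\<close>
    show "map read_tape (?R r) ! 2 \<noteq> 0 \<and> runs (write_rulers 0 St Lt) (?R r) 1 (?R (Suc r))"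
      by (simp add: algebra_simps Let_def) (simp add: conf_def ruler_def)
  qed (simp add: conf_def ruler_def Let_def)
  moreover have "runs (move_rulers Rt) (?R n) 1 (conf X 0 p q 0 0 0 0 out)"
    using runs_move_rulers[of Rt X 0 p q "-1" out] by (simp add: Let_def)
  ultimately have "runs erase_cmd (?S 0) ((n * (1 + 1) + 1) + (1 + ((n * (1 + 1) + 1) + 1)))
    (conf X 0 p q 0 0 0 0 out)"
    unfolding erase_cmd_def by (blast intro: runs_Seq)
  then have "runs erase_cmd (?S 0) (4 * n + 4) (conf X 0 p q 0 0 0 0 out)"
    by (rule runs_mono) simp
  then show ?thesis by simp
qed

text \<open>After printing, the first head is behind the matrix and the second is back at its start.
  Counting \<open>n * n\<close> moves to the right brings both to the next graph.\<close>

definition sync_cmd :: cmd where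
  "sync_cmd = for_i (for_j (move_copy Rt))"

lemma runs_sync_cmd:
  "runs sync_cmd (conf X n p q 0 0 0 0 out) (for_time n (for_time n 1))
    (conf X n p (q + int (n * n)) 0 0 0 0 out)"
proof -
  have line: "runs (for_j (move_copy Rt)) (conf X n p (q + int (i * n)) (int i) 0 0 0 out) (for_time n 1)
     (conf X n p (q + int (Suc i * n)) (int i) 0 0 0 out)" for i
  proof -
    have "runs (move_copy Rt) (conf X n p (q + int (i * n + j)) (int i) (int j) 0 0 out) 1
       (conf X n p (q + int (i * n + Suc j)) (int i) (int j) 0 0 out)" for j
      using runs_move_copy[of Rt X n p "q + int (i * n + j)"] by (simp add: algebra_simps)
    from runs_for_j[where q = "\<lambda>j. q + int (i * n + j)" and out = "\<lambda>_. out" and p = "\<lambda>_. p", OF this]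
    show ?thesis by (simp add: add.commute)
  qed
  show ?thesis unfolding sync_cmd_def
    using runs_for_i[where q = "\<lambda>i. q + int (i * n)" and out = "\<lambda>_. out" and p = "\<lambda>_. p", OF line] by simp
qed

text \<open>The machine has to be analysed on every string, so its reading is defined for an
  arbitrary tape: the number is the length of the run of symbols 2 from \<open>p\<close>, and later
  every matrix cell without a 2 counts as a non-edge.\<close>

definition lead :: "(int \<Rightarrow> nat) \<Rightarrow> int \<Rightarrow> nat" where
  "lead X p = (LEAST r. X (p + int r) \<noteq> 2)"

definition next_pos :: "(int \<Rightarrow> nat) \<Rightarrow> int \<Rightarrow> int" where
  "next_pos X p = (let n = lead X p in p + int n + 1 + int (n * n))"

definition graph_output :: "(int \<Rightarrow> nat) \<Rightarrow> int \<Rightarrow> bool list" where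
  "graph_output X p =
     (let n = lead X p in graph_code n (\<lambda>i j. X (p + int n + 1 + int (i * n + j)) = 2))"

definition graph_cmd :: cmd where
  "graph_cmd = Seq parse_cmd (Seq header_cmd (Seq matrix_cmd (Seq sync_cmd erase_cmd)))"

definition graph_time :: "nat \<Rightarrow> nat" where
  "graph_time n =
     (4 * n + 4) + (header_time n + (matrix_time n + (for_time n (for_time n 1) + (4 * n + 4))))"

lemma runs_graph_cmd:
  assumes "\<exists>r. X (p + int r) \<noteq> 2"
  shows "runs graph_cmd (conf X 0 p p 0 0 0 0 out) (graph_time (lead X p))
    (conf X 0 (next_pos X p) (next_pos X p) 0 0 0 0 (out @ graph_output X p))"
proof -
  define n where "n = lead X p"
  let ?P = "p + int n + 1"
  let ?h = "replicate (4 * (n * n)) True @ [False]"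
  have "X (p + int r) = 2" if "r < n" for r
    using that not_less_Least unfolding n_def lead_def by blast
  moreover have "X (p + int n) \<noteq> 2"
    using LeastI_ex[OF assms] unfolding n_def lead_def .
  ultimately have "runs parse_cmd (conf X 0 p p 0 0 0 0 out) (4 * n + 4) (conf X n ?P ?P 0 0 0 0 out)"
    by (rule runs_parse_cmd)
  from runs_Seq[OF this runs_Seq[OF runs_header_cmd runs_Seq[OF runs_matrix_cmd
    runs_Seq[OF runs_sync_cmd runs_erase_cmd]]]]
  show ?thesis
    by (simp add: graph_cmd_def graph_time_def n_def next_pos_def graph_output_def graph_code_def Let_def)
qed

text \<open>An output entry depends on two input cells at once, those of \<open>(i, j)\<close> and
  \<open>(k, l)\<close>; hence the copy of the input, which has a head of its own.\<close>

definition setup_cmd :: cmd where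
  "setup_cmd =
     Seq (Do (\<lambda>ss. keep (take 6 ss) @ replicate 4 (1, St) @ keep (drop 10 ss)))
    (Seq (While (\<lambda>ss. ss ! 0 \<noteq> 0) (Do (\<lambda>ss. replicate 2 (ss ! 0, Rt) @ keep (drop 2 ss))))
    (Seq (move [Lt, Lt, St, St, St, St, St, St, St, St, St])
    (Seq (While (\<lambda>ss. ss ! 0 \<noteq> 0) (move [Lt, Lt, St, St, St, St, St, St, St, St, St]))
         (move [Rt, Rt, St, St, St, St, St, St, St, St, St]))))"

lemma written_take_Suc:
  assumes "r < length x"
  shows "(written (take r x))(int r := written x (int r)) = written (take (Suc r) x)"
  using assms by (auto simp: written_def fun_eq_iff less_Suc_eq nat_less_iff)

lemma runs_setup_cmd:
  "runs setup_cmd ((written x, 0) # replicate 10 (\<lambda>_. 0, 0)) (4 * length x + 5)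
    (conf (written x) 0 0 0 0 0 0 0 [])"
proof -
  let ?N = "length x"
  let ?T = "\<lambda>y p. [(written x, p), (written y, p), (ruler 0, 0), (ruler 0, 0), (ruler 0, 0), (ruler 0, 0),
     (ruler 1, 0), (ruler 1, 0), (ruler 1, 0), (ruler 1, 0), (written [], 0)]"
  have r4: "replicate 4 a = [a, a, a, a]" for a :: "nat \<times> dir" by (simp add: numeral_eq_Suc)
  have r2: "replicate 2 a = [a, a]" for a :: "nat \<times> dir" by (simp add: numeral_eq_Suc)
  have r10: "replicate 10 a = [a, a, a, a, a, a, a, a, a, a]" for a :: tape by (simp add: numeral_eq_Suc)
  have "runs (Do (\<lambda>ss. keep (take 6 ss) @ replicate 4 (1, St) @ keep (drop 10 ss)))
     ((written x, 0) # replicate 10 (\<lambda>_. 0, 0)) 1 (?T (take 0 x) (int 0))"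
    by (rule runs_Do) (auto simp: keep_def r4 r10 fun_eq_iff written_def ruler_def)
  moreover have "runs (While (\<lambda>ss. ss ! 0 \<noteq> 0) (Do (\<lambda>ss. replicate 2 (ss ! 0, Rt) @ keep (drop 2 ss))))
     (?T (take 0 x) (int 0)) (?N * (1 + 1) + 1) (?T (take ?N x) (int ?N))"
  proof (rule runs_While)
    fix r assume r: "r < ?N"
    have "runs (Do (\<lambda>ss. replicate 2 (ss ! 0, Rt) @ keep (drop 2 ss))) (?T (take r x) (int r)) 1
       (?T (take (Suc r) x) (int (Suc r)))"
      by (rule runs_Do) (simp add: keep_def r2 written_take_Suc[OF r] add.commute)
    with r show "map read_tape (?T (take r x) (int r)) ! 0 \<noteq> 0 \<and>
      runs (Do (\<lambda>ss. replicate 2 (ss ! 0, Rt) @ keep (drop 2 ss))) (?T (take r x) (int r)) 1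
       (?T (take (Suc r) x) (int (Suc r)))"
      by (simp add: written_def)
  qed (simp add: written_def)
  moreover have "runs (move [Lt, Lt, St, St, St, St, St, St, St, St, St]) (?T (take ?N x) (int ?N)) 1
     (?T x (int ?N - 1 - int 0))"
    by (rule runs_move) simp_all
  moreover have "runs (While (\<lambda>ss. ss ! 0 \<noteq> 0) (move [Lt, Lt, St, St, St, St, St, St, St, St, St]))
     (?T x (int ?N - 1 - int 0)) (?N * (1 + 1) + 1) (?T x (int ?N - 1 - int ?N))"
  proof (rule runs_While)
    fix r assume r: "r < ?N"
    have "runs (move [Lt, Lt, St, St, St, St, St, St, St, St, St]) (?T x (int ?N - 1 - int r)) 1
     (?T x (int ?N - 1 - int (Suc r)))"
      by (rule runs_move) simp_all
    with r show "map read_tape (?T x (int ?N - 1 - int r)) ! 0 \<noteq> 0 \<and>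
      runs (move [Lt, Lt, St, St, St, St, St, St, St, St, St]) (?T x (int ?N - 1 - int r)) 1
     (?T x (int ?N - 1 - int (Suc r)))"
      by (simp add: written_def)
  qed (simp add: written_def)
  moreover have "runs (move [Rt, Rt, St, St, St, St, St, St, St, St, St]) (?T x (int ?N - 1 - int ?N)) 1
     (conf (written x) 0 0 0 0 0 0 0 [])"
    by (rule runs_move) (simp_all add: conf_def)
  ultimately have "runs setup_cmd ((written x, 0) # replicate 10 (\<lambda>_. 0, 0))
     (1 + ((?N * (1 + 1) + 1) + (1 + ((?N * (1 + 1) + 1) + 1)))) (conf (written x) 0 0 0 0 0 0 0 [])"
    unfolding setup_cmd_def by (blast intro: runs_Seq)
  then show ?thesis by (rule runs_mono) simp
qed

definition reduction_cmd :: cmd where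
  "reduction_cmd = Seq setup_cmd (Seq graph_cmd graph_cmd)"

definition reduction :: "bool list \<Rightarrow> bool list" where
  "reduction x =
     graph_output (written x) 0 @ graph_output (written x) (next_pos (written x) 0)"

lemma wf_move: "length ds = k \<Longrightarrow> wf_cmd k (move ds)"
  unfolding move_def by (auto dest: set_zip_leftD)

lemma wf_reduction_cmd: "wf_cmd 11 reduction_cmd"
proof -
  have keep: "(s, d) \<in> set (keep ss) \<longleftrightarrow> s \<in> set ss \<and> d = Stay" and len: "length (keep ss) = length ss"
    for s d ss by (auto simp: keep_def)
  have take: "s < 3" if "s \<in> set (take m ss)" "\<forall>s \<in> set ss. s < (3 :: nat)" for s m ss
    using that by (meson in_set_takeD)
  have drop: "s < 3" if "s \<in> set (drop m ss)" "\<forall>s \<in> set ss. s < (3 :: nat)" for s m ss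
    using that by (meson in_set_dropD)
  have [simp]: "wf_cmd 11 (emit b)" for b
    by (auto simp: emit_def keep len intro: take)
  have [simp]: "wf_cmd 11 (write_rulers v d e)" if "v < 3" for v d e
    using that by (auto simp: write_rulers_def keep len intro: take drop)
  have [simp]: "wf_cmd 11 (For r up down c)" if "length up = 11" "length down = 11" "wf_cmd 11 c" for r up down c
    using that by (simp add: For_def wf_move)
  have [simp]: "wf_cmd 11 (Do (\<lambda>ss. keep (take 6 ss) @ replicate 4 (v, St) @ keep (drop 10 ss)))"
    if "v < 3" for v
    using that by (auto simp: keep len intro: take drop)
  have [simp]: "wf_cmd 11 (Do (\<lambda>ss. replicate 2 (ss ! 0, Rt) @ keep (drop 2 ss)))"
    by (auto simp: keep len intro: take drop)
  show ?thesis
    by (simp add: reduction_cmd_def setup_cmd_def graph_cmd_def parse_cmd_def header_cmd_def matrix_cmd_def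
        sync_cmd_def erase_cmd_def row_cmd_def move_in_def move_copy_def move_rulers_def wf_move
        for_i_def for_j_def for_k_def for_l_def del: wf_cmd.simps(1))
qed

section \<open>Polynomial bound on the running time\<close>

definition polynomial_fun :: "(nat \<Rightarrow> nat) \<Rightarrow> bool" where
  "polynomial_fun f \<longleftrightarrow> (\<exists>p. \<forall>n. f n = poly p n)"

lemma polynomial_fun_const: "polynomial_fun (\<lambda>_. c)"
  unfolding polynomial_fun_def by (rule exI[of _ "[:c:]"]) simp

lemma polynomial_fun_id: "polynomial_fun (\<lambda>n. n)"
  unfolding polynomial_fun_def by (rule exI[of _ "[:0, 1:]"]) simp

lemma polynomial_fun_add: "polynomial_fun f \<Longrightarrow> polynomial_fun g \<Longrightarrow> polynomial_fun (\<lambda>n. f n + g n)"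
  unfolding polynomial_fun_def by (metis poly_add)

lemma polynomial_fun_mult: "polynomial_fun f \<Longrightarrow> polynomial_fun g \<Longrightarrow> polynomial_fun (\<lambda>n. f n * g n)"
  unfolding polynomial_fun_def by (metis poly_mult)

lemma polynomial_fun_graph_time: "polynomial_fun graph_time"
  unfolding graph_time_def header_time_def matrix_time_def row_time_def for_time_def
  by (intro polynomial_fun_add polynomial_fun_mult polynomial_fun_const polynomial_fun_id)

lemma for_time_mono: "n \<le> n' \<Longrightarrow> T \<le> T' \<Longrightarrow> for_time n T \<le> for_time n' T'"
  unfolding for_time_def by (intro add_mono mult_mono) auto

lemma graph_time_mono: "n \<le> n' \<Longrightarrow> graph_time n \<le> graph_time n'"
  unfolding graph_time_def header_time_def matrix_time_def row_time_def
  by (intro add_mono mult_mono for_time_mono) auto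

lemma polytime_computable_reduction: "polytime_computable reduction"
proof -
  obtain g where g: "graph_time n = poly g n" for n
    using polynomial_fun_graph_time unfolding polynomial_fun_def by blast
  let ?p = "[:5, 4:] + (g + g)"
  show ?thesis
  proof (rule polytime_computableI[OF wf_reduction_cmd])
    fix x
    let ?X = "written x"
    let ?p1 = "next_pos ?X 0"
    let ?p2 = "next_pos ?X ?p1"
    \<comment> \<open>From any nonnegative position, \<open>length x\<close> cells further the tape
      is blank. This bounds the number read by \<open>length x\<close> even on strings that encode
      nothing.\<close>
    have blank: "?X (p + int (length x)) \<noteq> 2" if "p \<ge> 0" for p
      using that by (simp add: written_def)
    have nonneg: "0 \<le> ?p1" by (simp add: next_pos_def Let_def)
    have lead: "lead ?X p \<le> length x" if "p \<ge> 0" for p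
      unfolding lead_def using blank[OF that] by (rule Least_le)
    have run: "runs graph_cmd (conf ?X 0 p p 0 0 0 0 out) (graph_time (length x))
       (conf ?X 0 (next_pos ?X p) (next_pos ?X p) 0 0 0 0 (out @ graph_output ?X p))" if "p \<ge> 0" for p out
      using runs_graph_cmd blank[OF that] graph_time_mono[OF lead[OF that]] by (blast intro: runs_mono)
    have "runs reduction_cmd ((written x, 0) # replicate 10 (\<lambda>_. 0, 0))
       ((4 * length x + 5) + (graph_time (length x) + graph_time (length x)))
       (conf ?X 0 ?p2 ?p2 0 0 0 0 (([] @ graph_output ?X 0) @ graph_output ?X ?p1))"
      unfolding reduction_cmd_def
      by (rule runs_Seq[OF runs_setup_cmd runs_Seq[OF run run]]) (simp_all add: nonneg)
    then have "runs reduction_cmd ((written x, 0) # replicate (11 - 1) (\<lambda>_. 0, 0)) (poly ?p (length x))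
       (conf ?X 0 ?p2 ?p2 0 0 0 0 (reduction x))"
      by (simp add: g reduction_def algebra_simps)
    then show "\<exists>ts. runs reduction_cmd ((written x, 0) # replicate (11 - 1) (\<lambda>_. 0, 0)) (poly ?p (length x)) ts \<and>
        fst (last ts) = written (reduction x)"
      by (intro exI conjI) (assumption, simp add: conf_def)
  qed simp
qed

section \<open>Graph isomorphisms\<close>

lemma graph_iso_sym:
  assumes "graph_iso G H"
  shows "graph_iso H G"
proof -
  obtain f where f: "bij_betw f (verts G) (verts H)"
    and e: "\<forall>u \<in> verts G. \<forall>v \<in> verts G. {u, v} \<in> edges G \<longleftrightarrow> {f u, f v} \<in> edges H"
    using assms unfolding graph_iso_def by blast
  let ?g = "inv_into (verts G) f"
  have g: "bij_betw ?g (verts H) (verts G)" using f by (rule bij_betw_inv_into)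
  have "{u, v} \<in> edges H \<longleftrightarrow> {?g u, ?g v} \<in> edges G" if "u \<in> verts H" "v \<in> verts H" for u v
    using e that bij_betwE[OF g] bij_betw_inv_into_right[OF f] by auto
  with g show ?thesis unfolding graph_iso_def by blast
qed

lemma graph_iso_trans:
  assumes "graph_iso G H" "graph_iso H K"
  shows "graph_iso G K"
proof -
  obtain f where f: "bij_betw f (verts G) (verts H)"
    and e: "\<forall>u \<in> verts G. \<forall>v \<in> verts G. {u, v} \<in> edges G \<longleftrightarrow> {f u, f v} \<in> edges H"
    using assms(1) unfolding graph_iso_def by blast
  obtain g where g: "bij_betw g (verts H) (verts K)"
    and e': "\<forall>u \<in> verts H. \<forall>v \<in> verts H. {u, v} \<in> edges H \<longleftrightarrow> {g u, g v} \<in> edges K"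
    using assms(2) unfolding graph_iso_def by blast
  have "bij_betw (g \<circ> f) (verts G) (verts K)" using f g by (rule bij_betw_trans)
  moreover have "{u, v} \<in> edges G \<longleftrightarrow> {(g \<circ> f) u, (g \<circ> f) v} \<in> edges K"
    if "u \<in> verts G" "v \<in> verts G" for u v
    using e e' that bij_betwE[OF f] by simp
  ultimately show ?thesis unfolding graph_iso_def by blast
qed

lemma contains_induced_iso:
  assumes "contains_induced G K" "graph_iso G H"
  shows "contains_induced H K"
proof -
  obtain S where S: "S \<subseteq> verts G" "graph_iso (induced_subgraph G S) K"
    using assms(1) unfolding contains_induced_def by blast
  obtain f where f: "bij_betw f (verts G) (verts H)"
    and e: "\<forall>u \<in> verts G. \<forall>v \<in> verts G. {u, v} \<in> edges G \<longleftrightarrow> {f u, f v} \<in> edges H"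
    using assms(2) unfolding graph_iso_def by blast
  have "graph_iso (induced_subgraph G S) (induced_subgraph H (f ` S))"
    unfolding graph_iso_def
  proof (intro exI conjI ballI)
    show "bij_betw f (verts (induced_subgraph G S)) (verts (induced_subgraph H (f ` S)))"
      using f S(1) by (auto simp: induced_subgraph_def bij_betw_def inj_on_subset)
    fix u v
    assume "u \<in> verts (induced_subgraph G S)" "v \<in> verts (induced_subgraph G S)"
    then show "{u, v} \<in> edges (induced_subgraph G S) \<longleftrightarrow> {f u, f v} \<in> edges (induced_subgraph H (f ` S))"
      using e S(1) by (auto simp: induced_subgraph_def)
  qed
  then have "graph_iso (induced_subgraph H (f ` S)) K"
    using S(2) graph_iso_sym graph_iso_trans by blast
  moreover have "f ` S \<subseteq> verts H" using f S(1) by (auto simp: bij_betw_def)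
  ultimately show ?thesis unfolding contains_induced_def by blast
qed

section \<open>Absence of the forbidden subgraph\<close>

text \<open>The only off-diagonal pair that a half of an arc meets is the one of that arc, so
  subdivision vertices have degree at most 2.\<close>

lemma incident_offdiag:
  assumes "incident A (i, j) y" "i \<noteq> j"
  shows "y = (i, j, 1) \<or> y = (i, j, 2)"
  using assms by (cases y) (auto simp: incident.simps split: if_splits)

text \<open>Half-edges have a single end, so two ends force a half of an arc, and irreflexivity
  keeps that arc from being a loop.\<close>

lemma incident_two:
  assumes "incident A x (i, j, s)" "incident A x' (i, j, s)" "x \<noteq> x'" "\<And>a. \<not> A a a"
  shows "i \<noteq> j \<and> (s = 1 \<and> {x, x'} = {(i, j), (i, i)} \<or> s = 2 \<and> {x, x'} = {(i, j), (j, j)})"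
  using assms by (cases x; cases x') (auto simp: incident.simps split: if_splits)

lemma incident_at_most_two:
  assumes "incident A x y" "incident A x' y" "incident A x'' y" "x \<noteq> x'" "x \<noteq> x''" "x' \<noteq> x''"
  shows False
proof -
  obtain i j s where y: "y = (i, j, s)" by (cases y)
  \<comment> \<open>The triple \<open>y\<close> alone determines the only two candidates for its
    ends; the rest is the pigeonhole principle.\<close>
  have "x = (i, j) \<or> x = (if s = 1 then (i, i) else (j, j))" if "incident A x y" for x
    using that by (cases x) (auto simp: y incident.simps split: if_splits)
  then show False using assms by metis
qed

text \<open>Two common ends determine the edge: the off-diagonal one is the arc, and the diagonal
  one tells which half it is.\<close>

lemma incident_no_parallel:
  assumes "incident A x y" "incident A x' y" "incident A x y'" "incident A x' y'"
    "x \<noteq> x'" "y \<noteq> y'" and irrefl: "\<And>a. \<not> A a a"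
  shows False
proof -
  obtain i j s where y: "y = (i, j, s)" by (cases y)
  obtain i' j' s' where y': "y' = (i', j', s')" by (cases y')
  have 1: "i \<noteq> j \<and> (s = 1 \<and> {x, x'} = {(i, j), (i, i)} \<or> s = 2 \<and> {x, x'} = {(i, j), (j, j)})"
    using incident_two[of A x i j s x'] assms y by blast
  have 2: "i' \<noteq> j' \<and> (s' = 1 \<and> {x, x'} = {(i', j'), (i', i')} \<or> s' = 2 \<and> {x, x'} = {(i', j'), (j', j')})"
    using incident_two[of A x i' j' s' x'] assms y' by blast
  show False using 1 2 \<open>y \<noteq> y'\<close> y y' by (auto simp: doubleton_eq_iff)
qed

text \<open>One end of a two-ended edge is a subdivision vertex, which has no room for two edges
  besides \<open>y\<close>.\<close>

lemma incident_thin_end: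
  assumes "incident A x y" "incident A x' y" "x \<noteq> x'" "\<And>a. \<not> A a a"
    and "incident A x y1" "incident A x y2" "y \<noteq> y1" "y \<noteq> y2" "y1 \<noteq> y2"
    and "incident A x' y3" "incident A x' y4" "y \<noteq> y3" "y \<noteq> y4" "y3 \<noteq> y4"
  shows False
proof -
  obtain i j s where y: "y = (i, j, s)" by (cases y)
  have "i \<noteq> j" "x = (i, j) \<or> x' = (i, j)"
    using incident_two[of A x i j s x'] assms(1-4) y by (simp_all add: doubleton_eq_iff) blast+
  moreover have False if "incident A (i, j) u" "incident A (i, j) v" "incident A (i, j) w"
    "u \<noteq> v" "u \<noteq> w" "v \<noteq> w" for u v w
    using that(4-6) that(1-3)[THEN incident_offdiag[OF _ \<open>i \<noteq> j\<close>]] by blast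
  ultimately show False using assms by blast
qed

section \<open>The bipartite complement and the forbidden subgraph\<close>

definition vertices :: "nat \<Rightarrow> (nat \<times> nat \<times> nat) set" where
  "vertices n = {..<n} \<times> {..<n} \<times> {..<4}"

definition triple_graph :: "nat \<Rightarrow> (nat \<Rightarrow> nat \<Rightarrow> bool) \<Rightarrow> (nat \<times> nat \<times> nat) graph" where
  "triple_graph n A = (vertices n, {{u, v} | u v. u \<in> vertices n \<and> v \<in> vertices n \<and> adj A u v})"

lemma adj_sym: "adj A u v \<longleftrightarrow> adj A v u"
  by (cases u; cases v) (auto simp: adj.simps)

definition side :: "nat \<times> nat \<times> nat \<Rightarrow> bool" where
  "side v \<longleftrightarrow> snd (snd v) = 0"

definition cell :: "nat \<times> nat \<times> nat \<Rightarrow> nat \<times> nat" where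
  "cell v = (fst v, fst (snd v))"

lemma adj_iff:
  "adj A u v \<longleftrightarrow> (side u \<and> \<not> side v \<and> \<not> incident A (cell u) v) \<or> (side v \<and> \<not> side u \<and> \<not> incident A (cell v) u)"
  by (cases u; cases v) (simp add: adj.simps side_def cell_def)

lemma cell_inject: "side u \<Longrightarrow> side v \<Longrightarrow> cell u = cell v \<longleftrightarrow> u = v"
  by (cases u; cases v) (auto simp: side_def cell_def)

lemma edges_triple_graph:
  "u \<in> vertices n \<Longrightarrow> v \<in> vertices n \<Longrightarrow> {u, v} \<in> edges (triple_graph n A) \<longleftrightarrow> adj A u v"
  using adj_sym[of A u v] unfolding triple_graph_def snd_conv mem_Collect_eq doubleton_eq_iff by blast

text \<open>Across the sides non-adjacency is incidence, and the ends of a path lie opposite its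
  centre. Each distribution of \<open>p1\<close>, \<open>q1\<close> and \<open>z\<close> over the
  sides then contradicts one of the sparsity properties of the incidence structure.\<close>

lemma no_two_P3_K1:
  assumes irrefl: "\<And>a. \<not> A a a"
    and p: "adj A p0 p1" "adj A p1 p2" and q: "adj A q0 q1" "adj A q1 q2"
    and ne: "p0 \<noteq> p2" "q0 \<noteq> q2" "z \<noteq> p0" "z \<noteq> p1" "z \<noteq> p2" "z \<noteq> q0" "z \<noteq> q1" "z \<noteq> q2" "p1 \<noteq> q1"
    and pq: "\<forall>a \<in> {p0, p1, p2}. \<forall>b \<in> {q0, q1, q2}. \<not> adj A a b"
    and z: "\<forall>a \<in> {p0, p1, p2, q0, q1, q2}. \<not> adj A z a"
  shows False
proof -
  have inc: "incident A (cell x) y" if "side x" "\<not> side y" "\<not> adj A x y \<or> \<not> adj A y x" for x y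
    using that by (simp add: adj_iff)
  have I: "incident A (cell x) y"
    if "side x" "\<not> side y" "x \<in> {p0, p1, p2} \<and> y \<in> {q0, q1, q2} \<or> y \<in> {p0, p1, p2} \<and> x \<in> {q0, q1, q2} \<or>
      x = z \<and> y \<in> {p0, p1, p2, q0, q1, q2} \<or> y = z \<and> x \<in> {p0, p1, p2, q0, q1, q2}" for x y
    using inc that pq z by metis
  have sp: "side p0 \<longleftrightarrow> \<not> side p1" "side p2 \<longleftrightarrow> \<not> side p1" using p by (auto simp: adj_iff)
  have sq: "side q0 \<longleftrightarrow> \<not> side q1" "side q2 \<longleftrightarrow> \<not> side q1" using q by (auto simp: adj_iff)
  consider "side p1" "side q1" "side z" | "side p1" "side q1" "\<not> side z" | "side p1" "\<not> side q1"
    | "\<not> side p1" "side q1" | "\<not> side p1" "\<not> side q1" "side z" | "\<not> side p1" "\<not> side q1" "\<not> side z"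
    by blast
  then show False
  proof cases
    case 1
    \<comment> \<open>The ends \<open>q0\<close>, \<open>q2\<close> are parallel edges between
      \<open>z\<close> and \<open>p1\<close>.\<close>
    show ?thesis
      by (rule incident_no_parallel[of A "cell z" q0 "cell p1" q2])
        (use 1 sp sq in \<open>simp_all add: I cell_inject ne ne[symmetric] irrefl\<close>)
  next
    case 2
    \<comment> \<open>Here \<open>z\<close> is an edge joining both centres, and each centre also
      meets the two ends of the other path.\<close>
    show ?thesis
      by (rule incident_thin_end[of A "cell p1" z "cell q1" q0 q2 p0 p2])
        (use 2 sp sq in \<open>simp_all add: I cell_inject ne ne[symmetric] irrefl\<close>)
  next
    case 3
    \<comment> \<open>The ends of the first path are parallel edges between the ends of the second;
      the next case is the mirror image.\<close>
    show ?thesis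
      by (rule incident_no_parallel[of A "cell q0" p0 "cell q2" p2])
        (use 3 sp sq in \<open>simp_all add: I cell_inject ne ne[symmetric] irrefl\<close>)
  next
    case 4
    show ?thesis
      by (rule incident_no_parallel[of A "cell p0" q0 "cell p2" q2])
        (use 4 sp sq in \<open>simp_all add: I cell_inject ne ne[symmetric] irrefl\<close>)
  next
    case 5
    \<comment> \<open>The edge \<open>p1\<close> would have the three ends \<open>q0\<close>,
      \<open>q2\<close> and \<open>z\<close>.\<close>
    show ?thesis
      by (rule incident_at_most_two[of A "cell q0" p1 "cell q2" "cell z"])
        (use 5 sp sq in \<open>simp_all add: I cell_inject ne ne[symmetric] irrefl\<close>)
  next
    case 6
    \<comment> \<open>\<open>p1\<close> is adjacent to \<open>p0\<close> and \<open>p2\<close> but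
      not to \<open>q0\<close>. So the edge \<open>z\<close> would have three distinct ends.\<close>
    have "p0 \<noteq> q0" "p2 \<noteq> q0" using p q pq by auto
    then show ?thesis
      by (intro incident_at_most_two[of A "cell p0" z "cell p2" "cell q0"])
        (use 6 sp sq in \<open>simp_all add: I cell_inject ne ne[symmetric] irrefl\<close>)
  qed
qed

lemma edges_disjoint_union:
  "{Inl a, Inl b} \<in> edges (disjoint_union G H) \<longleftrightarrow> {a, b} \<in> edges G"
  "{Inr c, Inr d} \<in> edges (disjoint_union G H) \<longleftrightarrow> {c, d} \<in> edges H"
  "{Inl a, Inr c} \<notin> edges (disjoint_union G H)"
  "{Inr c, Inl a} \<notin> edges (disjoint_union G H)"
proof -
  have l: "{Inl a, Inl b} = Inl ` e \<longleftrightarrow> {a, b} = e" for e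
    using inj_image_eq_iff[OF inj_Inl, of "{a, b}" e] by simp
  have r: "{Inr c, Inr d} = Inr ` e \<longleftrightarrow> {c, d} = e" for e
    using inj_image_eq_iff[OF inj_Inr, of "{c, d}" e] by simp
  show "{Inl a, Inl b} \<in> edges (disjoint_union G H) \<longleftrightarrow> {a, b} \<in> edges G"
    by (auto simp: disjoint_union_def image_iff l)
  show "{Inr c, Inr d} \<in> edges (disjoint_union G H) \<longleftrightarrow> {c, d} \<in> edges H"
    by (auto simp: disjoint_union_def image_iff r)
  show "{Inl a, Inr c} \<notin> edges (disjoint_union G H)" "{Inr c, Inl a} \<notin> edges (disjoint_union G H)"
    by (auto simp: disjoint_union_def set_eq_iff)
qed

lemma edges_path_graph: "{a, b} \<in> edges (path_graph n) \<longleftrightarrow> (b = Suc a \<and> b < n) \<or> (a = Suc b \<and> a < n)"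
  by (auto simp: path_graph_def doubleton_eq_iff)

lemma triple_graph_free:
  assumes irrefl: "\<And>a. \<not> A a a"
  shows "\<not> contains_induced (triple_graph n A) two_P3_K1"
proof
  assume "contains_induced (triple_graph n A) two_P3_K1"
  then obtain S where S: "S \<subseteq> vertices n"
    and "graph_iso (induced_subgraph (triple_graph n A) S) two_P3_K1"
    unfolding contains_induced_def by (auto simp: triple_graph_def)
  \<comment> \<open>Reversing the isomorphism makes the seven vertices available as images of named
    vertices.\<close>
  then have "graph_iso two_P3_K1 (induced_subgraph (triple_graph n A) S)" by (blast intro: graph_iso_sym)
  then obtain f where f: "bij_betw f (verts two_P3_K1) S"
    and "\<forall>u \<in> verts two_P3_K1. \<forall>v \<in> verts two_P3_K1.
      {u, v} \<in> edges two_P3_K1 \<longleftrightarrow> {f u, f v} \<in> edges (induced_subgraph (triple_graph n A) S)"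
    unfolding graph_iso_def by (auto simp: induced_subgraph_def)
  moreover have fS: "f u \<in> S" if "u \<in> verts two_P3_K1" for u
    using f that by (rule bij_betw_apply)
  ultimately have e: "{u, v} \<in> edges two_P3_K1 \<longleftrightarrow> adj A (f u) (f v)"
    if "u \<in> verts two_P3_K1" "v \<in> verts two_P3_K1" for u v
    using that fS[OF that(1)] fS[OF that(2)] subsetD[OF S]
    by (simp add: induced_subgraph_def edges_triple_graph)
  have inj: "f u = f v \<longleftrightarrow> u = v" if "u \<in> verts two_P3_K1" "v \<in> verts two_P3_K1" for u v
    using f that by (auto simp: bij_betw_def inj_on_def)
  have V: "Inl (Inl i) \<in> verts two_P3_K1 \<longleftrightarrow> i < 3" "Inl (Inr i) \<in> verts two_P3_K1 \<longleftrightarrow> i < 3"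
    "Inr i \<in> verts two_P3_K1 \<longleftrightarrow> i = 0" for i
    by (auto simp: two_P3_K1_def disjoint_union_def path_graph_def complete_graph_def)
  have E: "{Inl (Inl i), Inl (Inl j)} \<in> edges two_P3_K1 \<longleftrightarrow> (j = Suc i \<and> j < 3) \<or> (i = Suc j \<and> i < 3)"
    "{Inl (Inr i), Inl (Inr j)} \<in> edges two_P3_K1 \<longleftrightarrow> (j = Suc i \<and> j < 3) \<or> (i = Suc j \<and> i < 3)"
    "{Inl (Inl i), Inl (Inr j)} \<notin> edges two_P3_K1" "{Inr i, Inl a} \<notin> edges two_P3_K1" for i j a
    by (simp_all add: two_P3_K1_def edges_disjoint_union edges_path_graph)
  note facts = V E e[symmetric] inj
  show False
    by (rule no_two_P3_K1[of A "f (Inl (Inl 0))" "f (Inl (Inl 1))" "f (Inl (Inl 2))"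
          "f (Inl (Inr 0))" "f (Inl (Inr 1))" "f (Inl (Inr 2))" "f (Inr 0)"])
      (simp_all add: irrefl facts)
qed

section \<open>Isomorphisms of the constructed graphs\<close>

text \<open>Incidence is expressed by the relation and by equalities of indices alone, so renaming
  the indices coordinatewise preserves it.\<close>

lemma triple_graph_iso:
  assumes f: "bij_betw f {..<n} {..<m}"
    and e: "\<And>i j. i < n \<Longrightarrow> j < n \<Longrightarrow> A i j \<longleftrightarrow> B (f i) (f j)"
  shows "graph_iso (triple_graph n A) (triple_graph m B)"
proof -
  let ?F = "map_prod f (map_prod f id)"
  have F: "bij_betw ?F (vertices n) (vertices m)"
    unfolding vertices_def by (intro bij_betw_map_prod f bij_betw_id)
  have inj: "f i = f j \<longleftrightarrow> i = j" if "i < n" "j < n" for i j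
    using f that by (auto simp: bij_betw_def inj_on_def)
  have "adj A u v \<longleftrightarrow> adj B (?F u) (?F v)" if "u \<in> vertices n" "v \<in> vertices n" for u v
    using that by (cases u; cases v) (simp add: vertices_def adj.simps incident.simps inj e)
  then show ?thesis
    unfolding graph_iso_def using F bij_betwE[OF F]
    by (intro exI[of _ ?F]) (auto simp: edges_triple_graph simp: triple_graph_def[THEN arg_cong, of fst, simplified])
qed

section \<open>Recovering the original graph from adjacency and the two sides\<close>

definition X_side :: "nat \<Rightarrow> (nat \<times> nat \<times> nat) set" where
  "X_side n = {v \<in> vertices n. side v}"

definition Y_side :: "nat \<Rightarrow> (nat \<times> nat \<times> nat) set" where
  "Y_side n = {v \<in> vertices n. \<not> side v}"

definition is_vertex :: "nat \<Rightarrow> (nat \<Rightarrow> nat \<Rightarrow> bool) \<Rightarrow> nat \<times> nat \<times> nat \<Rightarrow> bool" where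
  "is_vertex n A x \<longleftrightarrow>
     x \<in> X_side n \<and> (\<exists>y \<in> Y_side n. \<not> adj A x y \<and> (\<forall>x' \<in> X_side n. \<not> adj A x' y \<longrightarrow> x' = x))"

definition linked :: "nat \<Rightarrow> (nat \<Rightarrow> nat \<Rightarrow> bool) \<Rightarrow> nat \<times> nat \<times> nat \<Rightarrow> nat \<times> nat \<times> nat \<Rightarrow> bool" where
  "linked n A u v \<longleftrightarrow>
     (\<exists>w \<in> X_side n. w \<noteq> u \<and> w \<noteq> v \<and>
       (\<exists>y \<in> Y_side n. \<not> adj A u y \<and> \<not> adj A w y) \<and> (\<exists>y \<in> Y_side n. \<not> adj A w y \<and> \<not> adj A v y))"

lemma X_side_iff: "(k, l, t) \<in> X_side n \<longleftrightarrow> k < n \<and> l < n \<and> t = 0"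
  by (auto simp: X_side_def vertices_def side_def)

lemma Y_side_iff: "(k, l, t) \<in> Y_side n \<longleftrightarrow> k < n \<and> l < n \<and> t \<in> {1, 2, 3}"
  by (auto simp: Y_side_def vertices_def side_def)

lemma not_adj_iff: "(k, l, 0) \<in> X_side n \<Longrightarrow> (i, j, s) \<in> Y_side n \<Longrightarrow>
    \<not> adj A (k, l, 0) (i, j, s) \<longleftrightarrow> incident A (k, l) (i, j, s)"
  by (auto simp: Y_side_iff adj.simps)

text \<open>The half-edge at \<open>(i, i)\<close> is private to it. An off-diagonal pair meets at
  most the halves of its own arc, and each of these has a diagonal end as well.\<close>

lemma is_vertex_iff:
  assumes irrefl: "\<And>a. \<not> A a a"
  shows "is_vertex n A x \<longleftrightarrow> (\<exists>i < n. x = (i, i, 0))"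
proof
  assume "\<exists>i < n. x = (i, i, 0)"
  then obtain i where i: "i < n" "x = (i, i, 0)" by blast
  have "x' = (i, i, 0)" if "x' \<in> X_side n" "\<not> adj A x' (i, i, 3)" for x'
    using that i by (cases x') (auto simp: X_side_iff adj.simps incident.simps)
  then show "is_vertex n A x"
    unfolding is_vertex_def using i
    by (intro conjI bexI[of _ "(i, i, 3)"]) (auto simp: X_side_iff Y_side_iff adj.simps incident.simps)
next
  assume x: "is_vertex n A x"
  then obtain y where xX: "x \<in> X_side n" and yY: "y \<in> Y_side n" "\<not> adj A x y"
    and uniq: "\<And>x'. x' \<in> X_side n \<Longrightarrow> \<not> adj A x' y \<Longrightarrow> x' = x"
    unfolding is_vertex_def by blast
  obtain k l where kl: "x = (k, l, 0)" "k < n" "l < n"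
    using xX by (cases x) (simp add: X_side_iff)
  obtain i j s where ys: "y = (i, j, s)" by (cases y)
  have y: "(i, j, s) \<in> Y_side n" "incident A (k, l) (i, j, s)"
    using yY xX by (simp_all add: kl ys not_adj_iff[symmetric])
  note uniq = uniq[unfolded ys]
  have ij: "i < n" "j < n" "s \<noteq> 0" using y by (auto simp: Y_side_iff)
  have "k = l"
  proof (rule ccontr)
    assume "k \<noteq> l"
    then have "A i j" "s = 1 \<or> s = 2" using y(2) by (auto simp: incident.simps split: if_splits)
    \<comment> \<open>Both ends of the half \<open>y\<close> are non-neighbours of \<open>y\<close>;
      uniqueness would identify them and turn the arc into a loop.\<close>
    then have "(i, j, 0) = x" "(if s = 1 then (i, i, 0) else (j, j, 0)) = x"
      using ij by (auto intro!: uniq simp: X_side_iff adj.simps incident.simps)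
    then show False using irrefl \<open>A i j\<close> by (auto split: if_splits)
  qed
  then show "\<exists>i < n. x = (i, i, 0)" using kl by blast
qed

text \<open>The middle vertex is the subdivision vertex of an arc. Conversely, a step from a
  diagonal pair to a different pair ends at the subdivision vertex of an arc at that vertex, so a
  middle vertex reached from both sides is \<open>(i, j)\<close> or \<open>(j, i)\<close>, and
  symmetry settles the latter.\<close>

lemma linked_iff:
  assumes irrefl: "\<And>a. \<not> A a a" and sym: "\<And>a b. A a b \<Longrightarrow> A b a"
    and ij: "i < n" "j < n" "i \<noteq> j"
  shows "linked n A (i, i, 0) (j, j, 0) \<longleftrightarrow> A i j"
proof
  assume "A i j"
  then show "linked n A (i, i, 0) (j, j, 0)"
    unfolding linked_def using ij
    by (intro bexI[of _ "(i, j, 0)"] conjI bexI[of _ "(i, j, 1)"] bexI[of _ "(i, j, 2)"])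
      (auto simp: X_side_iff Y_side_iff adj.simps incident.simps)
next
  have near: "w = (a, b) \<and> A a b \<and> (a = i \<or> b = i)"
    if "incident A (i, i) (a, b, s)" "incident A w (a, b, s)" "w \<noteq> (i, i)" for w a b s i
    using that by (cases w) (auto simp: incident.simps irrefl split: if_splits)
  assume "linked n A (i, i, 0) (j, j, 0)"
  then obtain v y y' where v: "v \<in> X_side n" "v \<noteq> (i, i, 0)" "v \<noteq> (j, j, 0)"
    and y: "y \<in> Y_side n" "\<not> adj A (i, i, 0) y" "\<not> adj A v y"
    and y': "y' \<in> Y_side n" "\<not> adj A v y'" "\<not> adj A (j, j, 0) y'"
    unfolding linked_def by blast
  obtain k l where [simp]: "v = (k, l, 0)" using v(1) by (cases v) (simp add: X_side_iff)
  obtain a b s where [simp]: "y = (a, b, s)" by (cases y)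
  obtain a' b' s' where [simp]: "y' = (a', b', s')" by (cases y')
  have "(k, l) = (a, b) \<and> A a b \<and> (a = i \<or> b = i)"
    using y v ij by (intro near[where s = s]) (simp_all add: not_adj_iff[symmetric] X_side_iff)
  moreover have "(k, l) = (a', b') \<and> A a' b' \<and> (a' = j \<or> b' = j)"
    using y' v ij by (intro near[where s = s']) (simp_all add: not_adj_iff[symmetric] X_side_iff)
  ultimately show "A i j" using sym ij by auto
qed

lemma finite_vertices: "finite (vertices n)" and card_vertices: "card (vertices n) = 4 * (n * n)"
  by (simp_all add: vertices_def card_cartesian_product)

text \<open>Adjacent triples go to opposite sides, so the image side of one triple adjacent to the
  whole vertex side fixes that of the vertex side, and then that of every triple with a neighbour
  there. Counting excludes the exchange of sides.\<close>

lemma X_side_image_subset: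
  assumes phi: "bij_betw \<phi> (vertices n) (vertices n)"
    and e: "\<And>u v. u \<in> vertices n \<Longrightarrow> v \<in> vertices n \<Longrightarrow> adj A u v \<longleftrightarrow> adj B (\<phi> u) (\<phi> v)"
    and irrefl: "\<And>a. \<not> A a a"
  shows "\<phi> ` X_side n \<subseteq> X_side n"
proof (cases "n = 0")
  case True
  then show ?thesis by (auto simp: X_side_def vertices_def)
next
  case False
  have V: "\<phi> u \<in> vertices n" if "u \<in> vertices n" for u
    using phi that by (rule bij_betw_apply)
  have opp: "side (\<phi> u) \<longleftrightarrow> \<not> side (\<phi> v)" if "adj A u v" "u \<in> vertices n" "v \<in> vertices n" for u v
    using that e[of u v] by (auto simp: adj_iff)
  \<comment> \<open>No arc is a loop, so this triple is incident with nothing.\<close>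
  let ?a = "(0, 0, 1) :: nat \<times> nat \<times> nat"
  have a: "?a \<in> vertices n" using False by (simp add: vertices_def)
  have univ: "adj A x ?a" if "x \<in> X_side n" for x
    using that irrefl by (cases x) (auto simp: X_side_iff adj.simps incident.simps)
  have "\<not> side (\<phi> ?a)"
  proof
    assume *: "side (\<phi> ?a)"
    \<comment> \<open>These two layers already outnumber the vertex side. The layer 3 is left out:
      for \<open>n = 1\<close> its triple has no neighbour.\<close>
    have "\<phi> ` ({..<n} \<times> {..<n} \<times> {1, 2}) \<subseteq> X_side n"
    proof (rule image_subsetI)
      fix v assume "v \<in> {..<n} \<times> {..<n} \<times> {1, 2 :: nat}"
      then obtain i j s where v: "v = (i, j, s)"
        and ij: "i \<in> {..<n}" "j \<in> {..<n}" and s: "s \<in> {1, 2 :: nat}"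
        by (cases v) simp
      \<comment> \<open>This is the diagonal pair at the opposite end of the arc, which this half
        does not meet; for \<open>i = j\<close> there is no arc at all.\<close>
      define x where "x = (if s = 1 then (j, j, 0 :: nat) else (i, i, 0))"
      have x: "x \<in> X_side n" and y: "(i, j, s) \<in> vertices n"
        using ij s by (auto simp: x_def X_side_iff vertices_def)
      have "adj A x (i, j, s)" using s irrefl by (auto simp: x_def adj.simps incident.simps)
      then have "side (\<phi> (i, j, s))"
        using opp[of x "(i, j, s)"] opp[OF univ[OF x]] * a x y by (auto simp: X_side_def)
      then show "\<phi> v \<in> X_side n" using V[OF y] v by (simp add: X_side_def)
    qed
    then have "card (\<phi> ` ({..<n} \<times> {..<n} \<times> {1, 2 :: nat})) \<le> card (X_side n)"
      by (rule card_mono[rotated]) (simp add: X_side_def finite_vertices)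
    moreover have "card (\<phi> ` ({..<n} \<times> {..<n} \<times> {1, 2 :: nat})) = 2 * (n * n)"
      using phi by (subst card_image) (auto simp: bij_betw_def vertices_def card_cartesian_product elim: inj_on_subset)
    moreover have "X_side n = {..<n} \<times> {..<n} \<times> {0}"
      by (auto simp: X_side_def vertices_def side_def)
    ultimately show False using False by (simp add: card_cartesian_product)
  qed
  then show ?thesis
    using opp[OF univ] a V by (auto simp: X_side_def)
qed

text \<open>
  The vertices \<open>(i, i, 0)\<close> are the elements of \<open>X_side\<close> with a private non-neighbour, and adjacency of \<open>i\<close>
  and \<open>j\<close> means that they are joined by a path of length 4 in the bipartite complement.
\<close>

lemma triple_graph_iso_imp:
  assumes iso: "graph_iso (triple_graph n A) (triple_graph m B)"
    and A: "\<And>a. \<not> A a a" "\<And>a b. A a b \<Longrightarrow> A b a"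
    and B: "\<And>a. \<not> B a a" "\<And>a b. B a b \<Longrightarrow> B b a"
  shows "\<exists>f. bij_betw f {..<n} {..<m} \<and> (\<forall>i < n. \<forall>j < n. A i j \<longleftrightarrow> B (f i) (f j))"
proof -
  obtain \<phi> where phi: "bij_betw \<phi> (vertices n) (vertices m)"
    and edges: "\<forall>u \<in> vertices n. \<forall>v \<in> vertices n.
      {u, v} \<in> edges (triple_graph n A) \<longleftrightarrow> {\<phi> u, \<phi> v} \<in> edges (triple_graph m B)"
    using iso unfolding graph_iso_def by (auto simp: triple_graph_def)
  have "4 * (n * n) = 4 * (m * m)"
    using bij_betw_same_card[OF phi] by (simp add: card_vertices)
  then have "n * n = m * m" by linarith
  then have [simp]: "m = n" by (metis power2_eq_square power2_eq_imp_eq le0)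
  note phi = phi[unfolded \<open>m = n\<close>]
  have e: "adj A u v \<longleftrightarrow> adj B (\<phi> u) (\<phi> v)" if "u \<in> vertices n" "v \<in> vertices n" for u v
    using edges that bij_betwE[OF phi] by (simp add: edges_triple_graph)
  have inj: "\<phi> u = \<phi> v \<longleftrightarrow> u = v" if "u \<in> vertices n" "v \<in> vertices n" for u v
    using phi that by (auto simp: bij_betw_def inj_on_def)
  have sub: "X_side n \<subseteq> vertices n" "Y_side n \<subseteq> vertices n" by (auto simp: X_side_def Y_side_def)
  note sub' = subsetD[OF sub(1)] subsetD[OF sub(2)]
  have inj': "inj_on \<phi> (X_side n)"
    using phi sub by (auto simp: bij_betw_def intro: inj_on_subset)
  \<comment> \<open>An injective image has the same finite size, so inclusion becomes
    equality.\<close>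
  have X: "X_side n = \<phi> ` X_side n"
    using X_side_image_subset[OF phi e A(1)] inj' finite_vertices
    by (metis (no_types, lifting) card_image card_subset_eq finite_subset sub(1))
  have Y: "Y_side n = \<phi> ` Y_side n"
  proof -
    have "Y_side n = vertices n - X_side n" by (auto simp: Y_side_def X_side_def)
    moreover have "\<phi> ` (vertices n - X_side n) = \<phi> ` vertices n - \<phi> ` X_side n"
      using phi sub(1) by (intro inj_on_image_set_diff[of _ "vertices n"]) (auto simp: bij_betw_def)
    ultimately show ?thesis using phi X by (simp add: bij_betw_def)
  qed
  \<comment> \<open>\<open>is_vertex\<close> and \<open>linked\<close> mention only the sides and
    adjacency, and \<open>\<phi>\<close> preserves both.\<close>
  have vtx: "is_vertex n B (\<phi> x) \<longleftrightarrow> is_vertex n A x" if "x \<in> vertices n" for x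
  proof -
    have "\<phi> x \<in> X_side n \<longleftrightarrow> x \<in> X_side n"
      using X inj that sub(1) by (metis (no_types, lifting) image_iff subsetD)
    moreover have "(\<exists>y \<in> Y_side n. \<not> adj B (\<phi> x) y \<and> (\<forall>x' \<in> X_side n. \<not> adj B x' y \<longrightarrow> x' = \<phi> x)) \<longleftrightarrow>
       (\<exists>y \<in> Y_side n. \<not> adj B (\<phi> x) (\<phi> y) \<and> (\<forall>x' \<in> X_side n. \<not> adj B (\<phi> x') (\<phi> y) \<longrightarrow> \<phi> x' = \<phi> x))"
      by (subst Y, subst X) simp
    moreover have "\<dots> \<longleftrightarrow> (\<exists>y \<in> Y_side n. \<not> adj A x y \<and> (\<forall>x' \<in> X_side n. \<not> adj A x' y \<longrightarrow> x' = x))"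
      by (simp add: e[symmetric] inj sub' that cong: bex_cong ball_cong)
    ultimately show ?thesis unfolding is_vertex_def by blast
  qed
  have link: "linked n B (\<phi> u) (\<phi> v) \<longleftrightarrow> linked n A u v" if "u \<in> vertices n" "v \<in> vertices n" for u v
  proof -
    have "linked n B (\<phi> u) (\<phi> v) \<longleftrightarrow>
      (\<exists>w \<in> X_side n. \<phi> w \<noteq> \<phi> u \<and> \<phi> w \<noteq> \<phi> v \<and>
       (\<exists>y \<in> Y_side n. \<not> adj B (\<phi> u) (\<phi> y) \<and> \<not> adj B (\<phi> w) (\<phi> y)) \<and>
       (\<exists>y \<in> Y_side n. \<not> adj B (\<phi> w) (\<phi> y) \<and> \<not> adj B (\<phi> v) (\<phi> y)))"
      unfolding linked_def by (subst X, subst (1 2) Y) simp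
    also have "\<dots> \<longleftrightarrow> linked n A u v"
      unfolding linked_def by (simp add: e[symmetric] inj sub' that cong: bex_cong)
    finally show ?thesis .
  qed
  let ?d = "\<lambda>i. (i, i, 0) :: nat \<times> nat \<times> nat"
  have d: "?d i \<in> vertices n" if "i < n" for i using that by (simp add: vertices_def)
  define f where "f i = fst (\<phi> (?d i))" for i
  have f: "f i < n \<and> \<phi> (?d i) = ?d (f i)" if "i < n" for i
    using vtx[OF d[OF that]] that unfolding is_vertex_iff[of A, OF A(1)] is_vertex_iff[of B, OF B(1)] f_def
    by auto
  have inj_f: "f i = f j \<longleftrightarrow> i = j" if "i < n" "j < n" for i j
    using f that inj[OF d[OF that(1)] d[OF that(2)]] by auto
  have "bij_betw f {..<n} {..<n}"
    unfolding bij_betw_def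
  proof
    show "inj_on f {..<n}" by (rule inj_onI) (simp add: inj_f)
    then show "f ` {..<n} = {..<n}" using f by (intro endo_inj_surj) auto
  qed
  moreover have "A i j \<longleftrightarrow> B (f i) (f j)" if "i < n" "j < n" for i j
  proof (cases "i = j")
    case True
    then show ?thesis using A(1) B(1) by simp
  next
    case False
    have "A i j \<longleftrightarrow> linked n A (?d i) (?d j)"
      using linked_iff[of A i n j] A that False by blast
    also have "\<dots> \<longleftrightarrow> linked n B (?d (f i)) (?d (f j))"
      using link[OF d[OF that(1)] d[OF that(2)]] f that by simp
    also have "\<dots> \<longleftrightarrow> B (f i) (f j)"
      using linked_iff[of B "f i" n "f j"] B f that False inj_f by blast
    finally show ?thesis .
  qed
  ultimately show ?thesis by auto
qed

section \<open>Encodings\<close>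

text \<open>These are the mixed-radix digits of \<open>v\<close> in the nesting order of the
  printing loops, so that row-major order is the order in which entries are printed.\<close>

definition triple :: "nat \<Rightarrow> nat \<Rightarrow> nat \<times> nat \<times> nat" where
  "triple n v = ((v div 4) div n, (v div 4) mod n, v mod 4)"

definition nat_graph :: "nat \<Rightarrow> (nat \<Rightarrow> nat \<Rightarrow> bool) \<Rightarrow> nat graph" where
  "nat_graph n A =
     ({..<4 * (n * n)},
      {{u, v} | u v. u < 4 * (n * n) \<and> v < 4 * (n * n) \<and> adj A (triple n u) (triple n v)})"

lemma edges_nat_graph:
  "{u, v} \<in> edges (nat_graph n A) \<longleftrightarrow>
     u < 4 * (n * n) \<and> v < 4 * (n * n) \<and> adj A (triple n u) (triple n v)"
  using adj_sym[of A "triple n u" "triple n v"]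
  unfolding nat_graph_def snd_conv mem_Collect_eq doubleton_eq_iff by blast

lemma verts_nat_graph: "verts (nat_graph n A) = {..<4 * (n * n)}"
  by (simp add: nat_graph_def)

lemma pair_index_less:
  assumes "i < a" "j < b"
  shows "i * b + j < a * (b :: nat)"
proof -
  have "i * b + j < Suc i * b" using assms(2) by simp
  also have "\<dots> \<le> a * b" using assms(1) by (intro mult_le_mono1) simp
  finally show ?thesis .
qed

lemma triple_index:
  assumes "j < n" "s < 4"
  shows "triple n ((i * n + j) * 4 + s) = (i, j, s)"
proof -
  have "(w * 4 + s) div 4 = w" "(w * 4 + s) mod 4 = s" for w using assms(2) by simp_all
  then show ?thesis using assms(1) by (simp only: triple_def) simp
qed

lemma bij_betw_triple: "bij_betw (triple n) {..<4 * (n * n)} (vertices n)"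
proof (rule bij_betw_byWitness[where f' = "\<lambda>(i, j, s). (i * n + j) * 4 + s"])
  show "\<forall>v \<in> {..<4 * (n * n)}. (case triple n v of (i, j, s) \<Rightarrow> (i * n + j) * 4 + s) = v"
    by (simp only: triple_def prod.case div_mult_mod_eq) simp
  show "\<forall>u \<in> vertices n. triple n (case u of (i, j, s) \<Rightarrow> (i * n + j) * 4 + s) = u"
    by (auto simp: vertices_def triple_index simp del: distrib_right_numeral)
  show "triple n ` {..<4 * (n * n)} \<subseteq> vertices n"
  proof (rule image_subsetI)
    fix v assume v: "v \<in> {..<4 * (n * n)}"
    then have "v div 4 < n * n" by (simp add: div_less_iff_less_mult mult.commute)
    moreover from this have "0 < n" by (cases n) simp_all
    ultimately show "triple n v \<in> vertices n"
      by (simp add: triple_def vertices_def div_less_iff_less_mult)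
  qed
  show "(\<lambda>(i, j, s). (i * n + j) * 4 + s) ` vertices n \<subseteq> {..<4 * (n * n)}"
  proof (rule image_subsetI)
    fix u assume "u \<in> vertices n"
    then obtain i j s where "u = (i, j, s)" "i < n" "j < n" "s < 4"
      by (cases u) (simp add: vertices_def)
    then show "(\<lambda>(i, j, s). (i * n + j) * 4 + s) u \<in> {..<4 * (n * n)}"
      using pair_index_less[OF pair_index_less, of i n j n s 4] by (simp add: mult.commute)
  qed
qed

lemma nat_graph_iso_triple_graph: "graph_iso (nat_graph n A) (triple_graph n A)"
  unfolding graph_iso_def
proof (intro exI conjI ballI)
  show "bij_betw (triple n) (verts (nat_graph n A)) (verts (triple_graph n A))"
    using bij_betw_triple by (simp add: verts_nat_graph triple_graph_def)
  fix u v assume "u \<in> verts (nat_graph n A)" "v \<in> verts (nat_graph n A)"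
  then show "{u, v} \<in> edges (nat_graph n A) \<longleftrightarrow> {triple n u, triple n v} \<in> edges (triple_graph n A)"
    using bij_betwE[OF bij_betw_triple[of n]]
    by (simp add: verts_nat_graph edges_nat_graph edges_triple_graph)
qed

lemma nat_graph_iso_iff:
  "graph_iso (nat_graph n A) (nat_graph m B) \<longleftrightarrow> graph_iso (triple_graph n A) (triple_graph m B)"
proof -
  note isos = nat_graph_iso_triple_graph[of n A] nat_graph_iso_triple_graph[of m B]
  note sym_isos = isos[THEN graph_iso_sym]
  show ?thesis
    using graph_iso_trans[OF graph_iso_trans[OF sym_isos(1)] isos(2)]
      graph_iso_trans[OF graph_iso_trans[OF isos(1)] sym_isos(2)] by blast
qed

lemma input_graph_nat_graph: "input_graph (nat_graph n A)"
proof -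
  have "u \<noteq> v" if "adj A (triple n u) (triple n v)" for u v
    using that by (auto simp: adj_iff)
  then show ?thesis
    unfolding input_graph_def simple_graph_def verts_nat_graph
    by (auto simp: nat_graph_def card_insert_if)
qed

lemma bipartite_nat_graph: "bipartite (nat_graph n A)"
  unfolding bipartite_def
proof (intro exI conjI ballI)
  let ?V = "{..<4 * (n * n)}"
  let ?X = "{v \<in> ?V. side (triple n v)}" and ?Y = "{v \<in> ?V. \<not> side (triple n v)}"
  show "?X \<union> ?Y = verts (nat_graph n A)" "?X \<inter> ?Y = {}"
    by (auto simp: verts_nat_graph)
  fix e assume "e \<in> edges (nat_graph n A)"
  then obtain u v where e: "e = {u, v}" "u \<in> ?V" "v \<in> ?V" and "adj A (triple n u) (triple n v)"
    by (auto simp: nat_graph_def)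
  then consider "u \<in> ?X" "v \<in> ?Y" | "u \<in> ?Y" "v \<in> ?X" by (auto simp: adj_iff)
  then show "\<exists>a \<in> ?X. \<exists>b \<in> ?Y. e = {a, b}"
    by cases (use e in blast)+
qed

lemma map_upt_mult:
  "map f [0..<a * b] = concat (map (\<lambda>i. map (\<lambda>j. f (i * b + j)) [0..<b]) [0..<a])"
proof (induction a)
  case (Suc a)
  have "[0..<Suc a * b] = [0..<a * b] @ map (\<lambda>j. j + a * b) [0..<b]"
    using upt_add_eq_append[of 0 "a * b" b] by (simp add: map_add_upt add.commute)
  then show ?case using Suc by (simp add: add.commute)
qed simp

lemma concat_concat_map: "concat (concat (map f xs)) = concat (map (\<lambda>x. concat (f x)) xs)"
  by (induction xs) auto

text \<open>With list-valued \<open>f\<close> the same regrouping serves within a row, where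
  \<open>f\<close> yields singletons, and across the rows.\<close>

lemma concat_map_vertices:
  fixes f :: "nat \<times> nat \<times> nat \<Rightarrow> 'a list"
  shows "concat (map (\<lambda>v. f (triple n v)) [0..<4 * (n * n)]) =
    concat (map (\<lambda>i. concat (map (\<lambda>j. concat (map (\<lambda>s. f (i, j, s)) [0..<4])) [0..<n])) [0..<n])"
proof -
  have "map (\<lambda>v. f (triple n v)) [0..<4 * (n * n)] =
    concat (map (\<lambda>w. map (\<lambda>s. f (triple n (w * 4 + s))) [0..<4]) [0..<n * n])"
    using map_upt_mult[of _ "n * n" 4] by (simp add: mult.commute)
  also have "map (\<lambda>w. map (\<lambda>s. f (triple n (w * 4 + s))) [0..<4]) [0..<n * n] =
    concat (map (\<lambda>i. map (\<lambda>j. map (\<lambda>s. f (triple n ((i * n + j) * 4 + s))) [0..<4]) [0..<n]) [0..<n])"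
    by (rule map_upt_mult)
  also have "\<dots> = concat (map (\<lambda>i. map (\<lambda>j. map (\<lambda>s. f (i, j, s)) [0..<4]) [0..<n]) [0..<n])"
    by (intro arg_cong[of _ _ concat] map_cong refl) (simp add: triple_index del: distrib_right_numeral)
  finally show ?thesis by (simp only: concat_concat_map)
qed

lemma encode_nat_graph: "encode_graph (nat_graph n A) = graph_code n A"
proof -
  have "map (\<lambda>v. {u, v} \<in> edges (nat_graph n A)) [0..<4 * (n * n)] = graph_row n A (triple n u)"
    if "u < 4 * (n * n)" for u
  proof -
    have "map (\<lambda>v. {u, v} \<in> edges (nat_graph n A)) [0..<4 * (n * n)] =
      concat (map (\<lambda>v. [adj A (triple n u) (triple n v)]) [0..<4 * (n * n)])"
      using that by (simp add: edges_nat_graph cong: map_cong)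
    also note concat_map_vertices
    also have "concat (map (\<lambda>i. concat (map (\<lambda>j. concat (map (\<lambda>s. [adj A (triple n u) (i, j, s)]) [0..<4])) [0..<n])) [0..<n]) =
      graph_row n A (triple n u)"
      by (simp add: graph_row_def)
    finally show ?thesis .
  qed
  then have "concat (map (\<lambda>u. map (\<lambda>v. {u, v} \<in> edges (nat_graph n A)) [0..<4 * (n * n)]) [0..<4 * (n * n)]) =
    concat (map (\<lambda>u. graph_row n A (triple n u)) [0..<4 * (n * n)])"
    by (intro arg_cong[of _ _ concat] map_cong) auto
  also note concat_map_vertices
  finally show ?thesis
    by (simp add: encode_graph_def verts_nat_graph graph_code_def Let_def)
qed

text \<open>The relation read off the tape is guaranteed to agree with adjacency only for indices
  below \<open>n\<close>.\<close>

lemma graph_code_cong: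
  assumes "\<And>i j. i < n \<Longrightarrow> j < n \<Longrightarrow> A i j \<longleftrightarrow> B i j"
  shows "graph_code n A = graph_code n B"
proof -
  have "adj A (i, j, s) (k, l, t) = adj B (i, j, s) (k, l, t)" if "i < n" "j < n" "k < n" "l < n" for i j s k l t
    using that assms by (simp add: adj.simps incident.simps)
  then show ?thesis unfolding graph_code_def graph_row_def
    by (intro arg_cong2[of _ _ _ _ append] arg_cong[of _ _ concat] map_cong refl) auto
qed

section \<open>Decoding the input\<close>

abbreviation joined :: "nat graph \<Rightarrow> nat \<Rightarrow> nat \<Rightarrow> bool" where
  "joined G i j \<equiv> {i, j} \<in> edges G"

lemma written_append:
  "int (length xs) \<le> p \<Longrightarrow> written (xs @ ys) p = written ys (p - int (length xs))"
  by (auto simp: written_def nth_append nat_diff_distrib)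

lemma written_prefix: "p < int (length xs) \<Longrightarrow> written (xs @ ys) p = written xs p"
  by (auto simp: written_def nth_append nat_less_iff)

lemma encode_graph_conv:
  assumes "verts G = {..<n}"
  shows "encode_graph G = replicate n True @ [False] @ map (\<lambda>v. joined G (v div n) (v mod n)) [0..<n * n]"
proof -
  have "map (\<lambda>v. joined G (v div n) (v mod n)) [0..<n * n] =
    concat (map (\<lambda>i. map (\<lambda>j. joined G i j) [0..<n]) [0..<n])"
    unfolding map_upt_mult by (intro arg_cong[of _ _ concat] map_cong refl) simp
  then show ?thesis by (simp add: encode_graph_def assms Let_def)
qed

lemma length_encode_graph: "verts G = {..<n} \<Longrightarrow> length (encode_graph G) = n + 1 + n * n"
  by (simp add: encode_graph_conv)

text \<open>The context \<open>pre\<close> and \<open>post\<close> is arbitrary so that both graphs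
  of a pair are covered: the first read from 0, the second from behind the first.\<close>

lemma read_encode_graph:
  fixes pre post :: "bool list"
  defines "p \<equiv> int (length pre)" and "X \<equiv> \<lambda>G. written (pre @ encode_graph G @ post)"
  assumes G: "verts G = {..<n}"
  shows "lead (X G) p = n"
    and "i < n \<Longrightarrow> j < n \<Longrightarrow> X G (p + int n + 1 + int (i * n + j)) = 2 \<longleftrightarrow> joined G i j"
proof -
  have X: "X G (p + int r) = (if encode_graph G ! r then 2 else 1)" if "r < n + 1 + n * n" for r
  proof -
    have "r < length (encode_graph G)" using that by (simp only: length_encode_graph[OF G])
    then have "X G (p + int r) = written (encode_graph G) (int r)"
      by (simp add: X_def p_def written_append written_prefix)
    also have "\<dots> = (if encode_graph G ! r then 2 else 1)"
      using \<open>r < length (encode_graph G)\<close> by (simp add: written_def)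
    finally show ?thesis .
  qed
  have "X G (p + int r) = 2" if "r < n" for r
    using that X[of r] by (simp add: encode_graph_conv[OF G] nth_append)
  moreover have "X G (p + int n) \<noteq> 2"
    using X[of n] by (simp add: encode_graph_conv[OF G] nth_append)
  ultimately show "lead (X G) p = n"
    unfolding lead_def by (intro Least_equality) (auto simp: not_less[symmetric])
  assume ij: "i < n" "j < n"
  let ?v = "i * n + j"
  have v: "?v < n * n" using ij by (rule pair_index_less)
  have "X G (p + int n + 1 + int ?v) = X G (p + int (n + 1 + ?v))"
    by (simp add: algebra_simps)
  also have "\<dots> = (if encode_graph G ! (n + 1 + ?v) then 2 else 1)"
    using X[of "n + 1 + ?v"] v by linarith
  also have "encode_graph G ! (n + 1 + ?v) = joined G i j"
    using v ij by (simp add: encode_graph_conv[OF G] nth_append)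
  finally show "X G (p + int n + 1 + int ?v) = 2 \<longleftrightarrow> joined G i j" by simp
qed

text \<open>Reading depends on the tape alone, so equal strings give the same order and the same
  matrix. The matrix determines the edge set because edges are two-element sets of vertices.\<close>

lemma encode_graph_append_inject:
  assumes G: "input_graph G" and H: "input_graph H"
    and eq: "encode_graph G @ x = encode_graph H @ y"
  shows "G = H \<and> x = y"
proof -
  obtain n where n: "verts G = {..<n}" using G unfolding input_graph_def by blast
  obtain m where m: "verts H = {..<m}" using H unfolding input_graph_def by blast
  have [simp]: "m = n"
    using read_encode_graph(1)[OF n, of "[]" x] read_encode_graph(1)[OF m, of "[]" y] eq by simp
  have j: "joined G i j \<longleftrightarrow> joined H i j" if "i < n" "j < n" for i j
    using read_encode_graph(2)[OF n, of i j "[]" x] read_encode_graph(2)[OF m, of i j "[]" y] eq that by simp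
  have sub: "edges G' \<subseteq> edges H'"
    if "input_graph G'" "verts G' = {..<n}" "\<And>i j. i < n \<Longrightarrow> j < n \<Longrightarrow> joined G' i j \<longleftrightarrow> joined H' i j"
    for G' H' :: "nat graph"
  proof
    fix e assume e: "e \<in> edges G'"
    then have "e \<subseteq> {..<n}" "card e = 2" using that(1,2) by (auto simp: input_graph_def simple_graph_def)
    then obtain i j where "e = {i, j}" "i < n" "j < n" by (auto simp: card_2_iff)
    then show "e \<in> edges H'" using that(3) e by blast
  qed
  have "edges G = edges H" using sub[of G H] sub[of H G] G H n m j by auto
  then have "G = H" using n m by (simp add: prod_eq_iff)
  then show ?thesis using eq by simp
qed

lemma encode_pair_inject:
  assumes "input_graph G" "input_graph H" "input_graph G'" "input_graph H'"
    and "encode_pair G H = encode_pair G' H'"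
  shows "G = G' \<and> H = H'"
  using assms encode_graph_append_inject[of G G' "encode_graph H" "encode_graph H'"]
    encode_graph_append_inject[of H H' "[]" "[]"] by (simp add: encode_pair_def)

definition target :: "nat graph \<Rightarrow> nat graph" where
  "target G = nat_graph (card (verts G)) (joined G)"

lemma graph_output_encode:
  assumes "input_graph G"
  shows "graph_output (written (pre @ encode_graph G @ post)) (int (length pre)) = encode_graph (target G)"
    and "next_pos (written (pre @ encode_graph G @ post)) (int (length pre)) = int (length (pre @ encode_graph G))"
proof -
  obtain n where n: "verts G = {..<n}" using assms unfolding input_graph_def by blast
  show "graph_output (written (pre @ encode_graph G @ post)) (int (length pre)) = encode_graph (target G)"
    unfolding graph_output_def Let_def read_encode_graph(1)[OF n]
    by (simp add: target_def encode_nat_graph n, rule graph_code_cong)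
      (use read_encode_graph(2)[OF n] in simp)
  show "next_pos (written (pre @ encode_graph G @ post)) (int (length pre)) = int (length (pre @ encode_graph G))"
    unfolding next_pos_def Let_def read_encode_graph(1)[OF n]
    by (simp add: length_encode_graph[OF n])
qed

lemma reduction_encode_pair:
  assumes "input_graph G" "input_graph H"
  shows "reduction (encode_pair G H) = encode_pair (target G) (target H)"
  using graph_output_encode[OF assms(1), of "[]" "encode_graph H"]
    graph_output_encode[OF assms(2), of "encode_graph G" "[]"]
  by (simp add: reduction_def encode_pair_def)

lemma joined_simps:
  assumes "input_graph G"
  shows "\<not> joined G a a" "joined G a b \<Longrightarrow> joined G b a"
  using assms by (auto simp: input_graph_def simple_graph_def insert_commute)

lemma target_iso_iff:
  assumes G: "input_graph G" and H: "input_graph H"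
  shows "graph_iso (target G) (target H) \<longleftrightarrow> graph_iso G H"
proof -
  obtain n where n: "verts G = {..<n}" using G unfolding input_graph_def by blast
  obtain m where m: "verts H = {..<m}" using H unfolding input_graph_def by blast
  have "graph_iso (triple_graph n (joined G)) (triple_graph m (joined H)) \<longleftrightarrow> graph_iso G H"
  proof
    assume "graph_iso (triple_graph n (joined G)) (triple_graph m (joined H))"
    from triple_graph_iso_imp[OF this joined_simps[OF G] joined_simps[OF H]]
    show "graph_iso G H" unfolding graph_iso_def n m by auto
  next
    assume "graph_iso G H"
    then show "graph_iso (triple_graph n (joined G)) (triple_graph m (joined H))"
      unfolding graph_iso_def[of G H] n m by (auto intro: triple_graph_iso)
  qed
  then show ?thesis by (simp add: target_def nat_graph_iso_iff n m)
qed

lemma target_free: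
  assumes "input_graph G"
  shows "\<not> contains_induced (target G) two_P3_K1"
proof
  assume "contains_induced (target G) two_P3_K1"
  then have "contains_induced (triple_graph (card (verts G)) (joined G)) two_P3_K1"
    unfolding target_def using nat_graph_iso_triple_graph by (rule contains_induced_iso)
  then show False using triple_graph_free[of "joined G", OF joined_simps(1)[OF assms]] by blast
qed

section \<open>The isomorphism problems and the two reductions\<close>

lemma instances_iff:
  "x \<in> instances (isomorphism_problem C) \<longleftrightarrow>
     (\<exists>G H. x = encode_pair G H \<and> input_graph G \<and> input_graph H \<and> C G \<and> C H)"
  by (simp add: isomorphism_problem_def)

text \<open>A yes-instance is only known to be the code of some isomorphic pair; injectivity of the
  code makes it the given pair.\<close>

lemma encode_pair_yes_iff:
  assumes "input_graph G" "input_graph H" "C G" "C H"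
  shows "encode_pair G H \<in> yes_instances (isomorphism_problem C) \<longleftrightarrow> graph_iso G H"
proof -
  have "encode_pair G H \<in> yes_instances (isomorphism_problem C) \<longleftrightarrow>
     (\<exists>G' H'. encode_pair G H = encode_pair G' H' \<and> input_graph G' \<and> input_graph H' \<and>
       C G' \<and> C H' \<and> graph_iso G' H')"
    by (simp add: isomorphism_problem_def)
  then show ?thesis using assms encode_pair_inject by metis
qed

theorem theorem5:
  "isomorphism_complete (\<lambda>G. bipartite G \<and> \<not> contains_induced G two_P3_K1)"
  unfolding isomorphism_complete_def polytime_equivalent_def
proof
  let ?C = "\<lambda>G. bipartite G \<and> \<not> contains_induced G two_P3_K1"
  show "polytime_reducible (isomorphism_problem ?C) (isomorphism_problem (\<lambda>_. True))"
    unfolding polytime_reducible_def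
  proof (intro exI[of _ "\<lambda>x. x"] conjI ballI polytime_computable_id)
    fix x assume "x \<in> instances (isomorphism_problem ?C)"
    then obtain G H where x: "x = encode_pair G H"
      and GH: "input_graph G" "input_graph H" and C: "?C G" "?C H"
      unfolding instances_iff by blast
    show "x \<in> instances (isomorphism_problem (\<lambda>_. True))"
      unfolding instances_iff using x GH by blast
    show "x \<in> yes_instances (isomorphism_problem ?C) \<longleftrightarrow> x \<in> yes_instances (isomorphism_problem (\<lambda>_. True))"
      unfolding x using encode_pair_yes_iff[of G H ?C] encode_pair_yes_iff[of G H "\<lambda>_. True"] GH C by blast
  qed
  show "polytime_reducible (isomorphism_problem (\<lambda>_. True)) (isomorphism_problem ?C)"
    unfolding polytime_reducible_def
  proof (intro exI[of _ reduction] conjI ballI polytime_computable_reduction)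
    fix x assume "x \<in> instances (isomorphism_problem (\<lambda>_. True))"
    then obtain G H where x: "x = encode_pair G H" and G: "input_graph G" and H: "input_graph H"
      unfolding instances_iff by blast
    have t: "input_graph (target K) \<and> ?C (target K)" if "input_graph K" for K
      using target_free[OF that] by (simp add: target_def input_graph_nat_graph bipartite_nat_graph)
    have r: "reduction x = encode_pair (target G) (target H)"
      unfolding x by (rule reduction_encode_pair[OF G H])
    show "reduction x \<in> instances (isomorphism_problem ?C)"
      unfolding instances_iff r using t[OF G] t[OF H] by blast
    have "x \<in> yes_instances (isomorphism_problem (\<lambda>_. True)) \<longleftrightarrow> graph_iso G H"
      unfolding x using encode_pair_yes_iff[of G H "\<lambda>_. True"] G H by blast
    also have "\<dots> \<longleftrightarrow> graph_iso (target G) (target H)" by (simp add: target_iso_iff[OF G H])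
    also have "\<dots> \<longleftrightarrow> reduction x \<in> yes_instances (isomorphism_problem ?C)"
      unfolding r using encode_pair_yes_iff[of "target G" "target H" ?C] t[OF G] t[OF H] by blast
    finally show "x \<in> yes_instances (isomorphism_problem (\<lambda>_. True)) \<longleftrightarrow>
      reduction x \<in> yes_instances (isomorphism_problem ?C)" .
  qed
qed

end
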